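(* For every $r\ge 2$, there is an algorithm for Test-$r$-Cover$(m-k)$ that runs in time $(r^2+1)^k(n+m)^{O(1)}$.
   Context: An edge $e$ of a hypergraph $(V,\mathcal{E})$ separates vertices $x,y$ if $|\{x,y\}\cap e|=1$; $\mathcal{T}\subseteq\mathcal{E}$ is a test cover if every pair of distinct vertices is separated by an edge of $\mathcal{T}$. Test-$r$-Cover$(m-k)$: given a hypergraph $H=(V,\mathcal{E})$ with $|V|=n$, $|\mathcal{E}|=m$, every edge of size at most $r$, $\mathcal{E}$ a test cover, and an integer parameter $k$, decide whether there is a test cover $\mathcal{T}\subseteq\mathcal{E}$ with at most $m-k$ edges. *)

theory Defs
  imports Main
begin

definition separates :: "'a set \<Rightarrow> 'a \<Rightarrow> 'a \<Rightarrow> bool" where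
  "separates e x y \<longleftrightarrow> card ({x, y} \<inter> e) = 1"

definition test_cover :: "'a set \<Rightarrow> 'a set set \<Rightarrow> bool" where
  "test_cover V T \<longleftrightarrow> (\<forall>x\<in>V. \<forall>y\<in>V. x \<noteq> y \<longrightarrow> (\<exists>e\<in>T. separates e x y))"

definition test_r_cover_input :: "nat \<Rightarrow> 'a set \<Rightarrow> 'a set set \<Rightarrow> bool" where
  "test_r_cover_input r V E \<longleftrightarrow>
     finite V \<and> E \<subseteq> Pow V \<and> (\<forall>e\<in>E. card e \<le> r) \<and> test_cover V E"

text \<open>The subtraction is over the integers, so there is no solution if \<open>k\<close> exceeds the
  number of edges.\<close>

definition test_cover_solvable :: "'a set \<Rightarrow> 'a set set \<Rightarrow> nat \<Rightarrow> bool" where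
  "test_cover_solvable V E k \<longleftrightarrow>
     (\<exists>T\<subseteq>E. test_cover V T \<and> int (card T) \<le> int (card E) - int k)"

text \<open>Algorithms are structured programs for a unit-cost random access machine. A state
  consists of registers and of a memory with indirect addressing, both holding natural numbers.
  The only arithmetic operations are addition and truncated subtraction; there is no unit-cost
  multiplication, so each step lengthens the largest number by at most one bit (apart from
  literals), and running times agree with those of Turing machines up to a polynomial in the
  time and the bit length of the input.\<close>

type_synonym state = "(nat \<Rightarrow> nat) \<times> (nat \<Rightarrow> nat)"

datatype com =
    Skip
  | Const nat nat     \<comment> \<open>\<open>Const i c\<close>: register \<open>i\<close> becomes the literal \<open>c\<close>\<close>
  | Move nat nat
  | Add nat nat nat   \<comment> \<open>\<open>Add i j l\<close>: register \<open>i\<close> becomes the sum of registers \<open>j\<close> and \<open>l\<close>\<close>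
  | Sub nat nat nat
  | Load nat nat      \<comment> \<open>\<open>Load i j\<close>: register \<open>i\<close> becomes the memory cell addressed by register \<open>j\<close>\<close>
  | Store nat nat     \<comment> \<open>\<open>Store i j\<close>: the memory cell addressed by register \<open>i\<close> becomes register \<open>j\<close>\<close>
  | Seq com com
  | Cond nat com com  \<comment> \<open>the first branch is taken iff the register is nonzero\<close>
  | While nat com      \<comment> \<open>loops as long as the register is nonzero\<close>

text \<open>\<open>exec c s t s'\<close>: started in \<open>s\<close>, the program \<open>c\<close> halts in \<open>s'\<close> after \<open>t\<close> steps.\<close>

inductive exec :: "com \<Rightarrow> state \<Rightarrow> nat \<Rightarrow> state \<Rightarrow> bool" where
  Skip: "exec Skip s 1 s"
| Const: "exec (Const i c) (R, M) 1 (R(i := c), M)"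
| Move: "exec (Move i j) (R, M) 1 (R(i := R j), M)"
| Add: "exec (Add i j l) (R, M) 1 (R(i := R j + R l), M)"
| Sub: "exec (Sub i j l) (R, M) 1 (R(i := R j - R l), M)"
| Load: "exec (Load i j) (R, M) 1 (R(i := M (R j)), M)"
| Store: "exec (Store i j) (R, M) 1 (R, M(R i := R j))"
| Seq: "exec c1 s1 t1 s2 \<Longrightarrow> exec c2 s2 t2 s3 \<Longrightarrow> exec (Seq c1 c2) s1 (t1 + t2) s3"
| CondTrue: "fst s i \<noteq> 0 \<Longrightarrow> exec c1 s t s' \<Longrightarrow> exec (Cond i c1 c2) s (Suc t) s'"
| CondFalse: "fst s i = 0 \<Longrightarrow> exec c2 s t s' \<Longrightarrow> exec (Cond i c1 c2) s (Suc t) s'"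
| WhileFalse: "fst s i = 0 \<Longrightarrow> exec (While i c) s 1 s"
| WhileTrue: "fst s1 i \<noteq> 0 \<Longrightarrow> exec c s1 t1 s2 \<Longrightarrow> exec (While i c) s2 t2 s3
    \<Longrightarrow> exec (While i c) s1 (Suc (t1 + t2)) s3"

inductive_cases exec_SkipE: "exec Skip s t s'"
  and exec_ConstE: "exec (Const i c) s t s'"
  and exec_MoveE: "exec (Move i j) s t s'"
  and exec_AddE: "exec (Add i j l) s t s'"
  and exec_SubE: "exec (Sub i j l) s t s'"
  and exec_LoadE: "exec (Load i j) s t s'"
  and exec_StoreE: "exec (Store i j) s t s'"
  and exec_SeqE: "exec (Seq c1 c2) s t s'"
  and exec_CondE: "exec (Cond i c1 c2) s t s'"
  and exec_WhileE: "exec (While i c) s t s'"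

lemmas exec_elims = exec_SkipE exec_ConstE exec_MoveE exec_AddE exec_SubE exec_LoadE
  exec_StoreE exec_SeqE exec_CondE

lemma exec_deterministic:
  "exec c s t s' \<Longrightarrow> exec c s u s'' \<Longrightarrow> u = t \<and> s'' = s'"
proof (induction arbitrary: u s'' rule: exec.induct)
  case (Seq c1 s1 t1 s2 c2 t2 s3)
  from Seq.prems show ?case
    by (rule exec_SeqE) (metis Seq.IH)
next
  case (CondTrue s i c1 t s' c2)
  from CondTrue.prems show ?case
    by (rule exec_CondE) (metis CondTrue.hyps(1) CondTrue.IH less_irrefl)+
next
  case (CondFalse s i c2 t s' c1)
  from CondFalse.prems show ?case
    by (rule exec_CondE) (metis CondFalse.hyps(1) CondFalse.IH less_irrefl)+
next
  case (WhileFalse s i c)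
  from WhileFalse.prems show ?case
    by (rule exec_WhileE) (use WhileFalse.hyps in simp_all)
next
  case (WhileTrue s1 i c t1 s2 t2 s3)
  from WhileTrue.prems show ?case
    by (rule exec_WhileE) (metis WhileTrue.hyps(1) WhileTrue.IH less_irrefl)+
qed (erule exec_elims; simp)+

text \<open>The input word occupies the memory from address 0 on; all other cells and all registers
  are initially 0. A halting program accepts iff register 0 is nonzero.\<close>

definition init_state :: "nat list \<Rightarrow> state" where
  "init_state xs = (\<lambda>_. 0, \<lambda>a. if a < length xs then xs ! a else 0)"

definition accepting :: "state \<Rightarrow> bool" where
  "accepting s \<longleftrightarrow> fst s 0 \<noteq> 0"

text \<open>The vertices are \<open>0, \<dots>, n - 1\<close>. The word consists of \<open>n\<close>, \<open>m\<close>, \<open>k\<close> and, for each of the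
  \<open>m\<close> edges, its size followed by its vertices. The edges and the vertices of an edge are listed
  without repetition but in any order, so an instance has several encodings.\<close>

definition encodes :: "nat list \<Rightarrow> nat set \<Rightarrow> nat set set \<Rightarrow> nat \<Rightarrow> bool" where
  "encodes xs V E k \<longleftrightarrow>
     (\<exists>n es. V = {..<n} \<and> E = set ` set es \<and> distinct (map set es) \<and> (\<forall>e\<in>set es. distinct e) \<and>
        xs = n # length es # k # concat (map (\<lambda>e. length e # e) es))"

end

theory Submission
  imports Defs
begin

text \<open>A test cover leaves at most one vertex uncovered. The algorithm guesses this vertex \<open>z\<close> (or
  that there is none), deletes all edges through it, and from then on also requires the remaining
  vertices to be covered. It then repeatedly takes a redundant edge \<open>e\<close> and branches over \<open>r\<^sup>2 + 1\<close>
  deletions: \<open>e\<close> itself or, if \<open>e\<close> stays, an edge determined by a vertex \<open>x\<close> of \<open>e\<close> and a vertex \<open>y\<close>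
  of another edge through \<open>x\<close>. Instead of recursing, the program enumerates all numbers below
  \<open>(r\<^sup>2 + 1) ^ min k m\<close> and reads the digits of each as a sequence of choices; soundness only needs
  the check of the final set of edges.\<close>

section \<open>A source language of bounded loops\<close>

text \<open>The guess of \<open>z\<close> is made for the covering requirement that it permits. If a
  redundant edge \<open>e\<close> cannot join the deleted edges of a solution, the reason is a pair
  \<open>x \<in> e\<close>, \<open>y \<notin> e\<close>, but \<open>y\<close> could be any vertex,
  too many to branch over. When coverage is required, a second edge \<open>f\<close> through
  \<open>x\<close> remains without \<open>e\<close>. Either \<open>f\<close> separates
  \<open>x\<close> from \<open>y\<close>, and then \<open>f\<close> itself is deleted by the
  solution, or \<open>y\<close> is one of the at most \<open>r\<close> vertices of \<open>f\<close>.
  This gives \<open>r\<close> choices of \<open>x\<close> times \<open>r\<close> choices of a vertex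
  of \<open>f\<close>, plus the deletion of \<open>e\<close>. Deleting \<open>f\<close> costs no
  extra digit: it is named by a vertex in both \<open>e\<close> and \<open>f\<close>, such as
  \<open>x\<close>, which \<open>y\<close> can never be. The second obstacle is the step count on
  the machine. Source programs are total functions with bounded loops, so their cost is bounded by
  structural recursion, polynomially for all but the outermost loop. The number of digits is cut to
  \<open>min k m\<close> because inner loops run that often and \<open>k\<close> alone is not
  bounded in terms of \<open>n + m\<close>.\<close>

datatype exp = Lit nat | Var nat | Plus exp exp | Minus exp exp | Deref exp

text \<open>\<open>For i v p\<close> reads register \<open>v\<close> once and lets \<open>i\<close> run downwards to \<open>0\<close>.\<close>

datatype prog =
    PSkip
  | Assign nat exp
  | Put exp exp
  | PSeq prog prog (infixr ";;" 60)
  | Ite exp prog prog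
  | For nat nat prog

fun ev :: "exp \<Rightarrow> state \<Rightarrow> nat" where
  "ev (Lit c) s = c"
| "ev (Var v) s = fst s v"
| "ev (Plus a b) s = ev a s + ev b s"
| "ev (Minus a b) s = ev a s - ev b s"
| "ev (Deref a) s = snd s (ev a s)"

fun downfor :: "nat \<Rightarrow> (nat \<Rightarrow> 's \<Rightarrow> 's) \<Rightarrow> 's \<Rightarrow> 's" where
  "downfor 0 f s = s"
| "downfor (Suc j) f s = downfor j f (f j s)"

fun run :: "prog \<Rightarrow> state \<Rightarrow> state" where
  "run PSkip s = s"
| "run (Assign v e) s = ((fst s)(v := ev e s), snd s)"
| "run (Put a e) s = (fst s, (snd s)(ev a s := ev e s))"
| "run (p ;; q) s = run q (run p s)"
| "run (Ite e p q) s = (if ev e s \<noteq> 0 then run p s else run q s)"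
| "run (For i v p) s = downfor (fst s v) (\<lambda>j t. run p ((fst t)(i := j), snd t)) s"

lemma downfor_invariant:
  assumes "I n s" and "\<And>j t. j < n \<Longrightarrow> I (Suc j) t \<Longrightarrow> I j (f j t)"
  shows "I 0 (downfor n f s)"
  using assms by (induction n arbitrary: s) auto

lemma for_invariant:
  assumes "I (fst s v) s"
    and "\<And>j t. j < fst s v \<Longrightarrow> I (Suc j) t \<Longrightarrow> I j (run p ((fst t)(i := j), snd t))"
  shows "I 0 (run (For i v p) s)"
  using downfor_invariant[of I "fst s v" s "\<lambda>j t. run p ((fst t)(i := j), snd t)"] assms by simp

fun writes :: "prog \<Rightarrow> nat set" where
  "writes PSkip = {}"
| "writes (Assign v e) = {v}"
| "writes (Put a e) = {}"
| "writes (p ;; q) = writes p \<union> writes q"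
| "writes (Ite e p q) = writes p \<union> writes q"
| "writes (For i v p) = insert i (writes p)"

text \<open>As long as no such register is written, the initial values bound every loop, however
  deeply nested, and the cost is known before the run. For this reason the programs loop over fixed
  bounds, such as the number of edges, and guard the body by a test.\<close>

fun loop_regs :: "prog \<Rightarrow> nat set" where
  "loop_regs (p ;; q) = loop_regs p \<union> loop_regs q"
| "loop_regs (Ite e p q) = loop_regs p \<union> loop_regs q"
| "loop_regs (For i v p) = insert v (loop_regs p)"
| "loop_regs _ = {}"

fun evars :: "exp \<Rightarrow> nat set" where
  "evars (Lit c) = {}"
| "evars (Var v) = {v}"
| "evars (Plus a b) = evars a \<union> evars b"
| "evars (Minus a b) = evars a \<union> evars b"
| "evars (Deref a) = evars a"

fun vars :: "prog \<Rightarrow> nat set" where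
  "vars PSkip = {}"
| "vars (Assign v e) = insert v (evars e)"
| "vars (Put a e) = evars a \<union> evars e"
| "vars (p ;; q) = vars p \<union> vars q"
| "vars (Ite e p q) = evars e \<union> vars p \<union> vars q"
| "vars (For i v p) = insert i (insert v (vars p))"

fun no_puts :: "prog \<Rightarrow> bool" where
  "no_puts (Put a e) = False"
| "no_puts (p ;; q) = (no_puts p \<and> no_puts q)"
| "no_puts (Ite e p q) = (no_puts p \<and> no_puts q)"
| "no_puts (For i v p) = no_puts p"
| "no_puts _ = True"

text \<open>A syntactic guarantee that the cells below the address in register \<open>v\<close>
  survive: an address \<open>Plus (Var v) b\<close> is never smaller than the value of
  \<open>v\<close>.\<close>

fun puts_above :: "nat \<Rightarrow> prog \<Rightarrow> bool" where
  "puts_above v (Put a e) = (\<exists>b. a = Plus (Var v) b)"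
| "puts_above v (p ;; q) = (puts_above v p \<and> puts_above v q)"
| "puts_above v (Ite e p q) = (puts_above v p \<and> puts_above v q)"
| "puts_above v (For i w p) = puts_above v p"
| "puts_above v _ = True"

section \<open>Frame properties\<close>

lemma run_frame: "v \<notin> writes p \<Longrightarrow> fst (run p s) v = fst s v"
proof (induction p arbitrary: s)
  case (For i w p)
  have "fst (downfor n (\<lambda>j t. run p ((fst t)(i := j), snd t)) s) v = fst s v" for n
    using For by (induction n arbitrary: s) auto
  then show ?case by simp
qed auto

lemma run_no_puts: "no_puts p \<Longrightarrow> snd (run p s) = snd s"
proof (induction p arbitrary: s)
  case (For i w p)
  have "snd (downfor n (\<lambda>j t. run p ((fst t)(i := j), snd t)) s) = snd s" for n
    using For by (induction n arbitrary: s) auto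
  then show ?case by simp
qed auto

lemma run_puts_above:
  "puts_above v p \<Longrightarrow> v \<notin> writes p \<Longrightarrow> a < fst s v \<Longrightarrow> snd (run p s) a = snd s a"
proof (induction p arbitrary: s)
  case (PSeq p q)
  then show ?case by (simp add: run_frame)
next
  case (For i w p)
  have "a < fst s v \<Longrightarrow> snd (downfor n (\<lambda>j t. run p ((fst t)(i := j), snd t)) s) a = snd s a" for n
    using For by (induction n arbitrary: s) (auto simp: run_frame)
  then show ?case using For by simp
qed auto

section \<open>Compilation to the random access machine\<close>

fun cexp :: "exp \<Rightarrow> nat \<Rightarrow> com" where
  "cexp (Lit c) t = Const t c"
| "cexp (Var v) t = Move t v"
| "cexp (Plus a b) t = Seq (cexp a t) (Seq (cexp b (Suc t)) (Add t t (Suc t)))"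
| "cexp (Minus a b) t = Seq (cexp a t) (Seq (cexp b (Suc t)) (Sub t t (Suc t)))"
| "cexp (Deref a) t = Seq (cexp a t) (Load t t)"

fun ecost :: "exp \<Rightarrow> nat" where
  "ecost (Lit c) = 1"
| "ecost (Var v) = 1"
| "ecost (Plus a b) = ecost a + (ecost b + 1)"
| "ecost (Minus a b) = ecost a + (ecost b + 1)"
| "ecost (Deref a) = ecost a + 1"

text \<open>Registers from \<open>t\<close> on are temporaries of the compiled code; a loop keeps its counter in
  register \<open>t\<close>, so that the body cannot tamper with it.\<close>

fun compile :: "prog \<Rightarrow> nat \<Rightarrow> com" where
  "compile PSkip t = Skip"
| "compile (Assign v e) t = Seq (cexp e t) (Move v t)"
| "compile (Put a e) t = Seq (cexp a t) (Seq (cexp e (Suc t)) (Store t (Suc t)))"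
| "compile (p ;; q) t = Seq (compile p t) (compile q t)"
| "compile (Ite e p q) t = Seq (cexp e t) (Cond t (compile p t) (compile q t))"
| "compile (For i v p) t = Seq (Move t v) (While t
     (Seq (Const (Suc t) 1) (Seq (Sub t t (Suc t)) (Seq (Move i t) (compile p (Suc t))))))"

text \<open>In a loop, \<open>4\<close> counts the loop test and the three instructions ahead of the
  body; \<open>2\<close> counts the loading of the counter and the final failing test. The sum over
  both branches of \<open>Ite\<close> replaces their maximum, which is good enough for a polynomial
  bound.\<close>

fun tcost :: "(nat \<Rightarrow> nat) \<Rightarrow> prog \<Rightarrow> nat" where
  "tcost b PSkip = 1"
| "tcost b (Assign v e) = ecost e + 1"
| "tcost b (Put a e) = ecost a + (ecost e + 1)"
| "tcost b (p ;; q) = tcost b p + tcost b q"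
| "tcost b (Ite e p q) = ecost e + Suc (tcost b p + tcost b q)"
| "tcost b (For i v p) = 2 + b v * (tcost b p + 4)"

lemma cexp_correct:
  assumes "\<forall>v\<in>evars e. v < T \<and> R v = \<sigma> v" "T \<le> t"
  shows "\<exists>R'. exec (cexp e t) (R, M) (ecost e) (R', M) \<and> R' t = ev e (\<sigma>, M) \<and> (\<forall>v<t. R' v = R v)"
  using assms
proof (induction e arbitrary: R t)
  case (Lit c)
  show ?case
    unfolding cexp.simps ecost.simps
    by (intro exI[of _ "R(t := c)"] conjI) (rule exec.Const, simp_all)
next
  case (Var v)
  then show ?case
    unfolding cexp.simps ecost.simps
    by (intro exI[of _ "R(t := R v)"] conjI) (rule exec.Move, simp_all)
next
  case (Plus a b)
  obtain R1 where 1: "exec (cexp a t) (R, M) (ecost a) (R1, M)" "R1 t = ev a (\<sigma>, M)"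
    "\<forall>v<t. R1 v = R v" using Plus.IH(1)[of R t] Plus.prems by auto
  have "\<forall>v\<in>evars b. v < T \<and> R1 v = \<sigma> v"
    using Plus.prems 1(3) by (metis UnI2 evars.simps(3) less_le_trans)
  then obtain R2 where 2: "exec (cexp b (Suc t)) (R1, M) (ecost b) (R2, M)" "R2 (Suc t) = ev b (\<sigma>, M)"
    "\<forall>v<Suc t. R2 v = R1 v" using Plus.IH(2)[of R1 "Suc t"] Plus.prems(2) by auto
  show ?case
    apply (rule exI[of _ "R2(t := R2 t + R2 (Suc t))"])
    using exec.Seq[OF 1(1) exec.Seq[OF 2(1) exec.Add[of t t "Suc t"]]] 1 2 by (simp add: fun_upd_def)
next
  case (Minus a b)
  obtain R1 where 1: "exec (cexp a t) (R, M) (ecost a) (R1, M)" "R1 t = ev a (\<sigma>, M)"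
    "\<forall>v<t. R1 v = R v" using Minus.IH(1)[of R t] Minus.prems by auto
  have "\<forall>v\<in>evars b. v < T \<and> R1 v = \<sigma> v"
    using Minus.prems 1(3) by (metis UnI2 evars.simps(4) less_le_trans)
  then obtain R2 where 2: "exec (cexp b (Suc t)) (R1, M) (ecost b) (R2, M)" "R2 (Suc t) = ev b (\<sigma>, M)"
    "\<forall>v<Suc t. R2 v = R1 v" using Minus.IH(2)[of R1 "Suc t"] Minus.prems(2) by auto
  show ?case
    apply (rule exI[of _ "R2(t := R2 t - R2 (Suc t))"])
    using exec.Seq[OF 1(1) exec.Seq[OF 2(1) exec.Sub[of t t "Suc t"]]] 1 2 by (simp add: fun_upd_def)
next
  case (Deref a)
  obtain R1 where 1: "exec (cexp a t) (R, M) (ecost a) (R1, M)" "R1 t = ev a (\<sigma>, M)"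
    "\<forall>v<t. R1 v = R v" using Deref.IH(1)[of R t] Deref.prems by auto
  show ?case
    apply (rule exI[of _ "R1(t := M (R1 t))"])
    using exec.Seq[OF 1(1) exec.Load[of t t]] 1 by (simp add: fun_upd_def)
qed

text \<open>Compiled code overwrites registers from \<open>T\<close> on, so machine and source state
  are comparable only below \<open>T\<close>.\<close>

definition agrees :: "nat \<Rightarrow> (nat \<Rightarrow> nat) \<Rightarrow> (nat \<Rightarrow> nat) \<Rightarrow> bool" where
  "agrees T R \<sigma> \<longleftrightarrow> (\<forall>v<T. R v = \<sigma> v)"

lemma cexp_correct_agrees:
  assumes "\<forall>v\<in>evars e. v < T" "agrees T R (fst s)" "T \<le> t"
  shows "\<exists>R'. exec (cexp e t) (R, snd s) (ecost e) (R', snd s) \<and> R' t = ev e s \<and> (\<forall>v<t. R' v = R v)"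
  using cexp_correct[of e T R "fst s" t "snd s"] assms by (auto simp: agrees_def)

text \<open>The last conclusion is what protects the counters of the enclosing loops: they lie from
  \<open>T\<close> on but below the \<open>t\<close> at which the inner code is compiled. A bound on
  the loop registers at the start stays valid because they are never written.\<close>

lemma compile_correct:
  assumes "\<forall>v\<in>vars p. v < T" "agrees T R (fst s)" "T \<le> t"
    and "\<forall>v\<in>loop_regs p. v \<notin> writes p" "\<forall>v\<in>loop_regs p. fst s v \<le> b v"
  shows "\<exists>R' \<tau>. exec (compile p t) (R, snd s) \<tau> (R', snd (run p s)) \<and> \<tau> \<le> tcost b p \<and>
    agrees T R' (fst (run p s)) \<and> (\<forall>v. T \<le> v \<and> v < t \<longrightarrow> R' v = R v)"
  using assms
proof (induction p arbitrary: R s t)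
  case PSkip
  then show ?case using exec.Skip by fastforce
next
  case (Assign v e)
  obtain R1 where 1: "exec (cexp e t) (R, snd s) (ecost e) (R1, snd s)" "R1 t = ev e s"
    "\<forall>v<t. R1 v = R v" using cexp_correct_agrees[of e T R s t] Assign.prems by auto
  show ?case
    apply (rule exI[of _ "R1(v := R1 t)"], rule exI[of _ "ecost e + 1"])
    using exec.Seq[OF 1(1) exec.Move[of v t]] 1 Assign.prems by (auto simp: agrees_def fun_upd_def)
next
  case (Put a e)
  obtain R1 where 1: "exec (cexp a t) (R, snd s) (ecost a) (R1, snd s)" "R1 t = ev a s"
    "\<forall>v<t. R1 v = R v" using cexp_correct_agrees[of a T R s t] Put.prems by auto
  have "agrees T R1 (fst s)" using 1 Put.prems by (auto simp: agrees_def)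
  then obtain R2 where 2: "exec (cexp e (Suc t)) (R1, snd s) (ecost e) (R2, snd s)"
    "R2 (Suc t) = ev e s" "\<forall>v<Suc t. R2 v = R1 v"
    using cexp_correct_agrees[of e T R1 s "Suc t"] Put.prems by auto
  show ?case
    apply (rule exI[of _ "R2"], rule exI[of _ "ecost a + (ecost e + 1)"])
    using exec.Seq[OF 1(1) exec.Seq[OF 2(1) exec.Store[of t "Suc t"]]] 1 2 Put.prems
    by (auto simp: agrees_def fun_upd_def)
next
  case (PSeq p q)
  obtain R1 t1 where 1: "exec (compile p t) (R, snd s) t1 (R1, snd (run p s))" "t1 \<le> tcost b p"
    "agrees T R1 (fst (run p s))" "\<forall>v. T \<le> v \<and> v < t \<longrightarrow> R1 v = R v"
    using PSeq.IH(1)[of R s t] PSeq.prems by auto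
  have "\<forall>v\<in>loop_regs q. fst (run p s) v \<le> b v"
  proof
    fix v assume v: "v \<in> loop_regs q"
    then have "v \<notin> writes p" using PSeq.prems by auto
    then show "fst (run p s) v \<le> b v" using v PSeq.prems by (simp add: run_frame)
  qed
  then obtain R2 t2 where 2: "exec (compile q t) (R1, snd (run p s)) t2 (R2, snd (run q (run p s)))"
    "t2 \<le> tcost b q" "agrees T R2 (fst (run q (run p s)))" "\<forall>v. T \<le> v \<and> v < t \<longrightarrow> R2 v = R1 v"
    using PSeq.IH(2)[OF _ 1(3) PSeq.prems(3)] PSeq.prems(1,4) by auto
  show ?case
    apply (rule exI[of _ "R2"], rule exI[of _ "t1 + t2"])
    using exec.Seq[OF 1(1) 2(1)] 1 2 by (simp add: add_mono)
next
  case (Ite e p q)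
  obtain R1 where 1: "exec (cexp e t) (R, snd s) (ecost e) (R1, snd s)" "R1 t = ev e s"
    "\<forall>v<t. R1 v = R v" using cexp_correct_agrees[of e T R s t] Ite.prems by auto
  have ag: "agrees T R1 (fst s)" using 1 Ite.prems by (auto simp: agrees_def)
  show ?case
  proof (cases "ev e s \<noteq> 0")
    case True
    obtain R2 t2 where 2: "exec (compile p t) (R1, snd s) t2 (R2, snd (run p s))"
      "t2 \<le> tcost b p" "agrees T R2 (fst (run p s))" "\<forall>v. T \<le> v \<and> v < t \<longrightarrow> R2 v = R1 v"
      using Ite.IH(1)[of R1 s t] Ite.prems ag by auto
    have "exec (Cond t (compile p t) (compile q t)) (R1, snd s) (Suc t2) (R2, snd (run p s))"
      by (rule exec.CondTrue) (use 1 2 True in auto)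
    from exec.Seq[OF 1(1) this] show ?thesis
      apply (intro exI[of _ "R2"] exI[of _ "ecost e + Suc t2"]) using True 1 2 by auto
  next
    case False
    obtain R2 t2 where 2: "exec (compile q t) (R1, snd s) t2 (R2, snd (run q s))"
      "t2 \<le> tcost b q" "agrees T R2 (fst (run q s))" "\<forall>v. T \<le> v \<and> v < t \<longrightarrow> R2 v = R1 v"
      using Ite.IH(2)[of R1 s t] Ite.prems ag by auto
    have "exec (Cond t (compile p t) (compile q t)) (R1, snd s) (Suc t2) (R2, snd (run q s))"
      by (rule exec.CondFalse) (use 1 2 False in auto)
    from exec.Seq[OF 1(1) this] show ?thesis
      apply (intro exI[of _ "R2"] exI[of _ "ecost e + Suc t2"]) using False 1 2 by auto
  qed
next
  case (For i v p)
  define f where "f = (\<lambda>j (u::state). run p ((fst u)(i := j), snd u))"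
  define c where "c = Seq (Const (Suc t) 1) (Seq (Sub t t (Suc t)) (Seq (Move i t) (compile p (Suc t))))"
  \<comment> \<open>The machine counter in \<open>t\<close> equals the number of rounds left, so the
    induction is on its value, with registers and source state arbitrary.\<close>
  have loop: "\<exists>R' \<tau>. exec (While t c) (R, snd u) \<tau> (R', snd (downfor n f u)) \<and>
     \<tau> \<le> 1 + n * (tcost b p + 4) \<and> agrees T R' (fst (downfor n f u)) \<and>
     (\<forall>v. T \<le> v \<and> v < t \<longrightarrow> R' v = R v)"
    if "R t = n" "agrees T R (fst u)" "\<forall>v\<in>loop_regs p. fst u v \<le> b v" for n R u
    using that
  proof (induction n arbitrary: R u)
    case 0
    then have "exec (While t c) (R, snd u) 1 (R, snd u)" by (intro exec.WhileFalse) simp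
    then show ?case using 0 by fastforce
  next
    case (Suc n)
    define R0 where "R0 = R(Suc t := 1, t := n, i := n)"
    define u0 where "u0 = ((fst u)(i := n), snd u)"
    have iT: "i < T" using For.prems by auto
    have e0: "exec (Const (Suc t) 1) (R, snd u) 1 (R(Suc t := 1), snd u)" by (rule exec.Const)
    have e1: "exec (Sub t t (Suc t)) (R(Suc t := 1), snd u) 1 (R(Suc t := 1, t := n), snd u)"
      using exec.Sub[of t t "Suc t" "R(Suc t := 1)" "snd u"] Suc.prems by simp
    have e2: "exec (Move i t) (R(Suc t := 1, t := n), snd u) 1 (R0, snd u0)"
      using exec.Move[of i t "R(Suc t := 1, t := n)" "snd u"] by (simp add: R0_def u0_def)
    have "agrees T R0 (fst u0)" using Suc.prems For.prems by (auto simp: agrees_def R0_def u0_def)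
    moreover have ini: "\<forall>v\<in>loop_regs p. fst u0 v \<le> b v"
      using Suc.prems For.prems by (auto simp: u0_def)
    ultimately obtain R1 t1 where 1: "exec (compile p (Suc t)) (R0, snd u0) t1 (R1, snd (run p u0))"
      "t1 \<le> tcost b p" "agrees T R1 (fst (run p u0))" "\<forall>v. T \<le> v \<and> v < Suc t \<longrightarrow> R1 v = R0 v"
      using For.IH[of R0 u0 "Suc t"] For.prems by auto
    have c: "exec c (R, snd u) (1 + (1 + (1 + t1))) (R1, snd (run p u0))"
      unfolding c_def by (intro exec.Seq[OF e0] exec.Seq[OF e1] exec.Seq[OF e2] 1(1))
    have R1t: "R1 t = n" using 1(4) For.prems iT by (auto simp: R0_def)
    have "\<forall>v\<in>loop_regs p. fst (run p u0) v \<le> b v"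
    proof
      fix v assume v: "v \<in> loop_regs p"
      then have "v \<notin> writes p" using For.prems by auto
      then show "fst (run p u0) v \<le> b v" using ini v by (simp add: run_frame)
    qed
    from Suc.IH[OF R1t 1(3) this]
    obtain R2 t2 where 2: "exec (While t c) (R1, snd (run p u0)) t2 (R2, snd (downfor n f (run p u0)))"
      "t2 \<le> 1 + n * (tcost b p + 4)" "agrees T R2 (fst (downfor n f (run p u0)))"
      "\<forall>v. T \<le> v \<and> v < t \<longrightarrow> R2 v = R1 v" by blast
    have fr: "\<forall>v. T \<le> v \<and> v < t \<longrightarrow> R2 v = R v"
      using 2(4) 1(4) iT by (auto simp: R0_def)
    have ex: "exec (While t c) (R, snd u) (Suc ((1 + (1 + (1 + t1))) + t2)) (R2, snd (downfor n f (run p u0)))"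
      by (rule exec.WhileTrue[OF _ c 2(1)]) (use Suc.prems in simp)
    show ?case
      apply (intro exI[of _ R2] exI[of _ "Suc ((1 + (1 + (1 + t1))) + t2)"])
      using ex fr 1(2) 2(2,3) by (simp add: f_def u0_def)
  qed
  have "agrees T (R(t := fst s v)) (fst s)" using For.prems by (auto simp: agrees_def)
  moreover have "\<forall>w\<in>loop_regs p. fst s w \<le> b w" using For.prems by auto
  ultimately obtain R2 t2 where 2: "exec (While t c) (R(t := fst s v), snd s) t2 (R2, snd (downfor (fst s v) f s))"
     "t2 \<le> 1 + fst s v * (tcost b p + 4)" "agrees T R2 (fst (downfor (fst s v) f s))"
     "\<forall>w. T \<le> w \<and> w < t \<longrightarrow> R2 w = (R(t := fst s v)) w"
    using loop[of "R(t := fst s v)" "fst s v" s] by auto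
  have Rv: "R v = fst s v" using For.prems by (auto simp: agrees_def)
  have 1: "exec (Move t v) (R, snd s) 1 (R(t := fst s v), snd s)"
    using exec.Move[of t v R "snd s"] Rv by simp
  have "fst s v * (tcost b p + 4) \<le> b v * (tcost b p + 4)"
    using For.prems by (intro mult_right_mono) auto
  then have "1 + t2 \<le> tcost b (For i v p)" unfolding tcost.simps using 2(2) by linarith
  then show ?case
    apply (intro exI[of _ R2] exI[of _ "1 + t2"])
    using exec.Seq[OF 1 2(1)] 2 For.prems by (simp add: f_def c_def)
qed

section \<open>Polynomial bounds on the cost\<close>

lemma tcost_polynomial:
  "\<exists>d. \<forall>N b. 2 \<le> N \<longrightarrow> (\<forall>v\<in>loop_regs p. b v \<le> N) \<longrightarrow> tcost b p \<le> N ^ d"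
proof -
  \<comment> \<open>Constants and sums both go into the exponent: \<open>x \<le> N ^ x\<close>, and
    doubling a power costs one more factor \<open>N \<ge> 2\<close>. Thus \<open>d\<close> depends
    on the program alone.\<close>
  have pw: "x \<le> N ^ x" if "2 \<le> N" for x N :: nat
    using power_gt_expt[of N x] that by simp
  have ex: "\<exists>d. \<forall>N. 2 \<le> N \<longrightarrow> x \<le> N ^ d" for x :: nat using pw by blast
  have sm: "N ^ a + N ^ c \<le> N ^ Suc (a + c)" if N: "2 \<le> N" for N a c :: nat
  proof -
    have "N ^ a \<le> N ^ (a + c)" "N ^ c \<le> N ^ (a + c)" using N by (auto intro!: power_increasing)
    then have "N ^ a + N ^ c \<le> 2 * N ^ (a + c)" by simp
    also have "\<dots> \<le> N * N ^ (a + c)" using N by (intro mult_right_mono) auto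
    finally show ?thesis by simp
  qed
  show ?thesis
  proof (induction p)
    case PSkip
    show ?case by (rule exI[of _ 0]) simp
  next
    case (Assign v e)
    show ?case by simp (use ex in blast)
  next
    case (Put a e)
    show ?case by simp (use ex in blast)
  next
    case (PSeq p q)
    then obtain d1 d2 where "\<forall>N b. 2 \<le> N \<longrightarrow> (\<forall>v\<in>loop_regs p. b v \<le> N) \<longrightarrow> tcost b p \<le> N ^ d1"
      "\<forall>N b. 2 \<le> N \<longrightarrow> (\<forall>v\<in>loop_regs q. b v \<le> N) \<longrightarrow> tcost b q \<le> N ^ d2" by blast
    then have "tcost b (p ;; q) \<le> N ^ Suc (d1 + d2)"
      if "2 \<le> N" "\<forall>v\<in>loop_regs (p ;; q). b v \<le> N" for N b
      using that sm[of N d1 d2] by (simp del: power_Suc) (meson UnI1 UnI2 add_mono le_trans)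
    then show ?case by blast
  next
    case (Ite e p q)
    then obtain d1 d2 where d: "\<forall>N b. 2 \<le> N \<longrightarrow> (\<forall>v\<in>loop_regs p. b v \<le> N) \<longrightarrow> tcost b p \<le> N ^ d1"
      "\<forall>N b. 2 \<le> N \<longrightarrow> (\<forall>v\<in>loop_regs q. b v \<le> N) \<longrightarrow> tcost b q \<le> N ^ d2" by blast
    have "tcost b (Ite e p q) \<le> N ^ Suc (Suc (ecost e) + Suc (d1 + d2))"
      if "2 \<le> N" "\<forall>v\<in>loop_regs (Ite e p q). b v \<le> N" for N b
    proof -
      have "tcost b p \<le> N ^ d1" "tcost b q \<le> N ^ d2" using d that by auto
      then have "tcost b (Ite e p q) \<le> Suc (ecost e) + (N ^ d1 + N ^ d2)" by simp
      also have "\<dots> \<le> N ^ Suc (ecost e) + N ^ Suc (d1 + d2)"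
        using pw[of N "Suc (ecost e)"] sm[of N d1 d2] that by (intro add_mono)
      also have "\<dots> \<le> N ^ Suc (Suc (ecost e) + Suc (d1 + d2))" using sm that by blast
      finally show ?thesis .
    qed
    then show ?case by blast
  next
    case (For i v p)
    then obtain d where d: "\<forall>N b. 2 \<le> N \<longrightarrow> (\<forall>v\<in>loop_regs p. b v \<le> N) \<longrightarrow> tcost b p \<le> N ^ d"
      by blast
    have "tcost b (For i v p) \<le> N ^ Suc (2 + Suc (Suc (d + 4)))"
      if "2 \<le> N" "\<forall>v\<in>loop_regs (For i v p). b v \<le> N" for N b
    proof -
      have "tcost b p \<le> N ^ d" using d that by auto
      moreover have "4 \<le> N ^ 4" "2 \<le> N ^ 2" using pw[of N 4] pw[of N 2] that by auto
      ultimately have "tcost b (For i v p) \<le> N ^ 2 + N * (N ^ d + N ^ 4)"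
        unfolding tcost.simps using that by (intro add_mono mult_mono) auto
      also have "\<dots> \<le> N ^ 2 + N * N ^ Suc (d + 4)"
        using sm[of N d 4] that by (intro add_mono mult_left_mono) auto
      also have "\<dots> = N ^ 2 + N ^ Suc (Suc (d + 4))" by (simp only: power_Suc)
      also have "\<dots> \<le> N ^ Suc (2 + Suc (Suc (d + 4)))" using sm that by blast
      finally show ?thesis .
    qed
    then show ?case by blast
  qed
qed

section \<open>The branching procedure\<close>

locale hypergraph_word =
  fixes n r :: nat and es :: "nat list list"
  assumes edge_subset: "e \<in> set es \<Longrightarrow> set e \<subseteq> {..<n}"
    and length_le_n: "e \<in> set es \<Longrightarrow> length e \<le> n"
    and length_le_r: "e \<in> set es \<Longrightarrow> length e \<le> r"
begin

abbreviation m :: nat where "m \<equiv> length es"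

abbreviation B :: nat where "B \<equiv> r\<^sup>2 + 1"

definition sep :: "nat \<Rightarrow> nat \<Rightarrow> nat \<Rightarrow> bool" where
  "sep j x y \<longleftrightarrow> (x \<in> set (es ! j)) \<noteq> (y \<in> set (es ! j))"

definition cov :: "nat set \<Rightarrow> nat set \<Rightarrow> bool" where
  "cov U J \<longleftrightarrow> (\<forall>x\<in>U. \<forall>y\<in>U. x \<noteq> y \<longrightarrow> (\<exists>j\<in>J. sep j x y))"

text \<open>The vertex \<open>n\<close> lies in no edge, so being separated from it means being covered. When all
  edges through a vertex \<open>z\<close> have been deleted, \<open>z\<close> and \<open>n\<close> are twins and \<open>z\<close> is dropped.\<close>

definition verts :: "nat \<Rightarrow> nat set" where
  "verts z = {..n} - {z}"

text \<open>Serves twice: it supplies the candidates of the branching, and a value below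
  \<open>m\<close> certifies that \<open>x\<close> and \<open>y\<close> remain separated when
  \<open>e\<close> is dropped as well. With \<open>e = m\<close> no further edge is dropped.\<close>

definition first_sep :: "nat set \<Rightarrow> nat \<Rightarrow> nat \<Rightarrow> nat \<Rightarrow> nat" where
  "first_sep D e x y = (LEAST j. j = m \<or> j < m \<and> j \<notin> D \<and> j \<noteq> e \<and> sep j x y)"

definition redundant :: "nat \<Rightarrow> nat set \<Rightarrow> nat" where
  "redundant z D = (LEAST e. e = m \<or> e < m \<and> e \<notin> D \<and> cov (verts z) ({..<m} - D - {e}))"

text \<open>Edges are given by their index in \<open>es\<close>, and \<open>m\<close> means that there is none. \<open>D\<close> is the set of
  deleted edges, and the digit \<open>d\<close> encodes the choice to be made.\<close>

definition step :: "nat \<Rightarrow> nat set \<Rightarrow> nat \<Rightarrow> nat set \<Rightarrow> bool" where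
  "step z D d D' \<longleftrightarrow>
     d = r * r \<and> D' = D \<union> ({redundant z D} \<inter> {..<m}) \<or>
     (\<exists>a b e f x y. e = redundant z D \<and> e < m \<and> a < length (es ! e) \<and> x = es ! e ! a \<and>
        f = first_sep D e x n \<and> f < m \<and> b < length (es ! f) \<and> y = es ! f ! b \<and> d = r * a + b \<and>
        D' = D \<union> ({first_sep D e x (if sep e y n then n else y)} \<inter> {..<m}))"

text \<open>A partial relation: a digit that names no suitable vertices admits no
  \<open>step\<close>. Nothing is claimed about what the program deletes on such digits.\<close>

fun path :: "nat \<Rightarrow> nat \<Rightarrow> nat set \<Rightarrow> nat \<Rightarrow> nat set \<Rightarrow> bool" where
  "path z 0 D w D' \<longleftrightarrow> D' = D"
| "path z (Suc i) D w D' \<longleftrightarrow> (\<exists>D1. step z D (w div B ^ i) D1 \<and> path z i D1 (w mod B ^ i) D')"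

lemma nth_less_n: "j < m \<Longrightarrow> x \<in> set (es ! j) \<Longrightarrow> x < n"
  using edge_subset[of "es ! j"] nth_mem by blast

lemma sep_n: "j < m \<Longrightarrow> sep j x n \<longleftrightarrow> x \<in> set (es ! j)"
  using nth_less_n by (auto simp: sep_def)

lemma cov_mono: "cov U J \<Longrightarrow> J \<subseteq> J' \<Longrightarrow> cov U J'"
  unfolding cov_def by blast

lemma first_sep_cases: "first_sep D e x y = m \<or> first_sep D e x y < m \<and> first_sep D e x y \<notin> D \<and> first_sep D e x y \<noteq> e
    \<and> sep (first_sep D e x y) x y"
  unfolding first_sep_def by (rule LeastI[of _ m]) simp

lemma first_sep_less_iff: "first_sep D e x y < m \<longleftrightarrow> (\<exists>j<m. j \<notin> D \<and> j \<noteq> e \<and> sep j x y)"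
proof
  assume "first_sep D e x y < m"
  then show "\<exists>j<m. j \<notin> D \<and> j \<noteq> e \<and> sep j x y"
    using first_sep_cases[of D e x y] by auto
next
  assume "\<exists>j<m. j \<notin> D \<and> j \<noteq> e \<and> sep j x y"
  then obtain j where j: "j < m" "j \<notin> D \<and> j \<noteq> e \<and> sep j x y" by blast
  then have "first_sep D e x y \<le> j" unfolding first_sep_def by (intro Least_le) simp
  then show "first_sep D e x y < m" using j by simp
qed

lemma redundant_cases: "redundant z D = m \<or> redundant z D < m \<and> redundant z D \<notin> D \<and>
    cov (verts z) ({..<m} - D - {redundant z D})"
  unfolding redundant_def by (rule LeastI[of _ m]) simp

lemma redundant_less:
  "e < m \<Longrightarrow> e \<notin> D \<Longrightarrow> cov (verts z) ({..<m} - D - {e}) \<Longrightarrow> redundant z D < m"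
  using Least_le[of "\<lambda>e. e = m \<or> e < m \<and> e \<notin> D \<and> cov (verts z) ({..<m} - D - {e})" e]
  by (simp add: redundant_def)

text \<open>If a solution \<open>S\<close> cannot be enlarged by the redundant edge \<open>e\<close>, then some pair
  \<open>x \<in> e\<close>, \<open>y \<notin> e\<close> is separated only by \<open>e\<close> and by edges of \<open>S\<close>. An edge \<open>f \<noteq> e\<close> through \<open>x\<close>
  lies in \<open>S\<close> or contains \<open>y\<close>; in the latter case any edge other than \<open>e\<close> that separates
  \<open>x\<close> and \<open>y\<close> lies in \<open>S\<close>. This leaves \<open>1 + r * r\<close> candidates for a deletion.\<close>

lemma branching:
  assumes S: "D \<subseteq> S" "S \<subseteq> {..<m}" "cov (verts z) ({..<m} - S)" and z: "z \<noteq> n"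
    and e: "e < m" "e \<notin> D" "cov (verts z) ({..<m} - D - {e})"
    and not: "\<not> cov (verts z) ({..<m} - insert e S)"
  shows "\<exists>x\<in>set (es ! e). \<exists>y\<in>set (es ! first_sep D e x n). first_sep D e x n < m \<and>
    first_sep D e x (if sep e y n then n else y) \<in> S - D"
proof -
  obtain x y where xy: "x \<in> verts z" "y \<in> verts z" "x \<noteq> y" "\<forall>j\<in>{..<m} - insert e S. \<not> sep j x y"
    "x \<in> set (es ! e)" "y \<notin> set (es ! e)"
  proof -
    obtain x y where 1: "x \<in> verts z" "y \<in> verts z" "x \<noteq> y" "\<forall>j\<in>{..<m} - insert e S. \<not> sep j x y"
      using not unfolding cov_def by blast
    obtain j where j: "j \<in> {..<m} - S" "sep j x y" using 1 S(3) unfolding cov_def by blast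
    then have "j = e" using 1 by blast
    then consider "x \<in> set (es ! e)" "y \<notin> set (es ! e)" | "y \<in> set (es ! e)" "x \<notin> set (es ! e)"
      using j unfolding sep_def by blast
    then show ?thesis
    proof cases
      case 1 then show ?thesis using that[of x y] \<open>x \<in> verts z\<close> \<open>y \<in> verts z\<close> \<open>x \<noteq> y\<close>
        \<open>\<forall>j\<in>{..<m} - insert e S. \<not> sep j x y\<close> by blast
    next
      case 2
      have "\<forall>j\<in>{..<m} - insert e S. \<not> sep j y x"
        using \<open>\<forall>j\<in>{..<m} - insert e S. \<not> sep j x y\<close> unfolding sep_def by blast
      then show ?thesis using that[of y x] 2 \<open>x \<in> verts z\<close> \<open>y \<in> verts z\<close> \<open>x \<noteq> y\<close> by blast
    qed
  qed
  have inS: "first_sep D e x w \<in> S - D" if "first_sep D e x w < m" "sep (first_sep D e x w) x y" for w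
  proof -
    have "first_sep D e x w \<notin> D" "first_sep D e x w \<noteq> e" using first_sep_cases[of D e x w] that by auto
    then show ?thesis using xy(4) that by blast
  qed
  have xn: "x < n" using nth_less_n e xy by blast
  \<comment> \<open>Here coverage enters: \<open>e\<close> is redundant even though \<open>x\<close>
    must be separated from \<open>n\<close>, so another edge that is not deleted passes through
    \<open>x\<close>.\<close>
  have "n \<in> verts z" using z by (simp add: verts_def)
  then obtain j where "j \<in> {..<m} - D - {e}" "sep j x n"
    using e(3) xy(1) xn unfolding cov_def by (metis less_irrefl)
  then have f: "first_sep D e x n < m" unfolding first_sep_less_iff by blast
  then have xf: "x \<in> set (es ! first_sep D e x n)" using first_sep_cases[of D e x n] sep_n by auto
  show ?thesis
  proof (cases "y \<in> set (es ! first_sep D e x n)")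
    case True
    obtain j where "j \<in> {..<m} - D - {e}" "sep j x y"
      using e(3) xy unfolding cov_def by blast
    then have g: "first_sep D e x y < m" unfolding first_sep_less_iff by blast
    then have "sep (first_sep D e x y) x y" using first_sep_cases[of D e x y] by auto
    moreover have "\<not> sep e y n" using sep_n e xy by blast
    ultimately show ?thesis using True f xy(5) inS[OF g] by auto
  next
    case False
    then have "sep (first_sep D e x n) x y" using xf by (simp add: sep_def)
    \<comment> \<open>The witness for the second vertex is \<open>x\<close> itself, which lies in
      both edges. As it lies in \<open>e\<close>, the conditional selects \<open>n\<close>, and the
      edge to be deleted is the one through \<open>x\<close> found first.\<close>
    moreover have "sep e x n" using sep_n e xy by blast
    ultimately show ?thesis using xf f xy(5) inS[OF f] by auto
  qed
qed

text \<open>The solution \<open>S\<close> is only a witness and may grow: it absorbs the redundant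
  edge whenever that leaves a solution, and otherwise already contains one of the branching
  candidates. When no edge is redundant, \<open>D\<close> is all of \<open>S\<close> and the digit
  \<open>r * r\<close> changes nothing, which allows all paths to have the same length.\<close>

lemma step_exists:
  assumes S: "D \<subseteq> S" "S \<subseteq> {..<m}" "cov (verts z) ({..<m} - S)" and z: "z \<noteq> n"
  shows "\<exists>d<B. \<exists>D' S'. step z D d D' \<and> D \<subseteq> D' \<and> D' \<subseteq> S' \<and> S' \<subseteq> {..<m} \<and>
    cov (verts z) ({..<m} - S') \<and> card S \<le> card S' \<and> (card D < card D' \<or> card S \<le> card D)"
proof -
  define e where "e = redundant z D"
  have finS: "finite S" by (rule finite_subset[OF S(2)]) simp
  have finD: "finite D" by (rule finite_subset[OF S(1) finS])
  have rr: "r * r < B" by (simp add: power2_eq_square)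
  consider "e = m" | "e < m" "e \<notin> D" "cov (verts z) ({..<m} - D - {e})"
    using redundant_cases[of z D] by (auto simp: e_def)
  then show ?thesis
  proof cases
    case 1
    \<comment> \<open>An edge of \<open>S\<close> outside \<open>D\<close> would be redundant,
      because the edges outside \<open>S\<close> suffice.\<close>
    have "S \<subseteq> D"
    proof (rule ccontr)
      assume "\<not> S \<subseteq> D"
      then obtain j where j: "j \<in> S" "j \<notin> D" by blast
      then have "cov (verts z) ({..<m} - D - {j})"
        using cov_mono[OF S(3), of "{..<m} - D - {j}"] S(1) by blast
      then have "redundant z D < m" using redundant_less[of j D z] j S(2) by blast
      then show False using 1 e_def by simp
    qed
    then have "D = S" using S by blast
    moreover have "step z D (r * r) D" using 1 by (simp add: step_def e_def)
    ultimately show ?thesis using S rr by blast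
  next
    case 2
    show ?thesis
    proof (cases "cov (verts z) ({..<m} - insert e S)")
      case True
      have "step z D (r * r) (insert e D)" using 2 by (auto simp: step_def e_def)
      moreover have "card S \<le> card (insert e S)" using finS by (simp add: card_insert_le)
      moreover have "card D < card (insert e D)" using finD 2 by simp
      moreover have "insert e S \<subseteq> {..<m}" "insert e D \<subseteq> insert e S" using S 2 by auto
      ultimately show ?thesis using True rr by blast
    next
      case False
      obtain x y where xy: "x \<in> set (es ! e)" "y \<in> set (es ! first_sep D e x n)" "first_sep D e x n < m"
        "first_sep D e x (if sep e y n then n else y) \<in> S - D"
        using branching[OF S z 2 False] by blast
      define g where "g = first_sep D e x (if sep e y n then n else y)"
      define f where "f = first_sep D e x n"
      obtain a b where a: "a < length (es ! e)" "x = es ! e ! a"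
        and b: "b < length (es ! f)" "y = es ! f ! b"
        using xy unfolding f_def by (metis in_set_conv_nth)
      have g: "g \<in> S" "g \<notin> D" using xy(4) unfolding g_def by auto
      have fm: "f < m" using xy(3) by (simp add: f_def)
      have gD: "insert g D = D \<union> ({first_sep D e x (if sep e y n then n else y)} \<inter> {..<m})"
        using g S(2) unfolding g_def by auto
      have "step z D (r * a + b) (insert g D)"
        unfolding step_def
        by (intro disjI2 exI[of _ a] exI[of _ b] exI[of _ e] exI[of _ f] exI[of _ x] exI[of _ y] conjI
          e_def 2(1) a f_def fm b refl gD)
      moreover have "r * a + b < B"
      proof -
        have "length (es ! e) \<le> r" using 2(1) length_le_r by simp
        then have "a < r" using a by simp
        moreover have "length (es ! f) \<le> r" using xy(3) length_le_r by (simp add: f_def)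
        then have "b < r" using b by simp
        ultimately have "r * a + b < r * Suc a" by simp
        also have "\<dots> \<le> r * r" using \<open>a < r\<close> by (intro mult_left_mono) auto
        finally show ?thesis using rr by simp
      qed
      moreover have "card D < card (insert g D)" using finD g by simp
      ultimately show ?thesis using S g by blast
    qed
  qed
qed

text \<open>\<open>q \<le> card D + i\<close> says that the \<open>i\<close> remaining steps
  suffice. A step preserves it: either \<open>D\<close> gains an edge, or \<open>D\<close> is
  already as large as \<open>S\<close> and hence has at least \<open>q\<close> edges.\<close>

lemma path_exists:
  assumes "D \<subseteq> S" "S \<subseteq> {..<m}" "cov (verts z) ({..<m} - S)" "z \<noteq> n" "q \<le> card S" "q \<le> card D + i"
  shows "\<exists>w<B ^ i. \<exists>D'. path z i D w D' \<and> D \<subseteq> D' \<and> D' \<subseteq> {..<m} \<and> cov (verts z) ({..<m} - D') \<and> q \<le> card D'"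
  using assms
proof (induction i arbitrary: D S)
  case 0
  have "cov (verts z) ({..<m} - D)" using cov_mono[OF 0(3)] 0(1) by blast
  then show ?case using 0 by auto
next
  case (Suc i)
  obtain d D1 S1 where 1: "d < B" "step z D d D1" "D \<subseteq> D1" "D1 \<subseteq> S1" "S1 \<subseteq> {..<m}"
    "cov (verts z) ({..<m} - S1)" "card S \<le> card S1" "card D < card D1 \<or> card S \<le> card D"
    using step_exists[OF Suc.prems(1-4)] by (elim exE conjE) (rule that; assumption)
  have "finite D1" by (rule finite_subset[OF subset_trans[OF 1(4,5)]]) simp
  then have "card D \<le> card D1" using 1(3) by (rule card_mono)
  then have "q \<le> card D1 + i" using 1 Suc.prems by linarith
  then obtain w D2 where 2: "w < B ^ i" "path z i D1 w D2" "D1 \<subseteq> D2" "D2 \<subseteq> {..<m}"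
    "cov (verts z) ({..<m} - D2)" "q \<le> card D2"
    using Suc.IH[OF 1(4,5,6) Suc.prems(4)] 1(7) Suc.prems(5) by (meson le_trans)
  \<comment> \<open>The digit of the current step is put in front as the most significant one, in
    the order in which \<open>path\<close> reads them.\<close>
  have "d * B ^ i + w < Suc d * B ^ i" using 2 by simp
  also have "\<dots> \<le> B * B ^ i" using 1 by (intro mult_right_mono) auto
  finally have w: "d * B ^ i + w < B ^ Suc i" by simp
  have "(d * B ^ i + w) div B ^ i = d" "(d * B ^ i + w) mod B ^ i = w" using 2(1) by auto
  then have "path z (Suc i) D (d * B ^ i + w) D2" using 1 2 by auto
  then show ?case using w 1 2 by (meson subset_trans)
qed

section \<open>The uncovered vertex and its twin \<open>n\<close>\<close>

definition twin :: "nat \<Rightarrow> nat \<Rightarrow> nat" where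
  "twin z x = (if x = z then n else x)"

lemma sep_twin:
  assumes "j < m" "z \<notin> set (es ! j)"
  shows "sep j (twin z x) (twin z y) \<longleftrightarrow> sep j x y"
  using assms nth_less_n[of j n] by (auto simp: sep_def twin_def)

lemma cov_verts_imp:
  assumes J: "J \<subseteq> {..<m}" and z: "\<And>j. j \<in> J \<Longrightarrow> z \<notin> set (es ! j)" and c: "cov (verts z) J"
    and "z \<noteq> n"
  shows "cov {..<n} J"
  unfolding cov_def
proof (intro ballI impI)
  fix x y assume xy: "x \<in> {..<n}" "y \<in> {..<n}" "x \<noteq> y"
  then have "twin z x \<in> verts z" "twin z y \<in> verts z" "twin z x \<noteq> twin z y"
    using assms by (auto simp: twin_def verts_def)
  then obtain j where "j \<in> J" "sep j (twin z x) (twin z y)" using c unfolding cov_def by blast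
  then show "\<exists>j\<in>J. sep j x y" using sep_twin J z by blast
qed

text \<open>If \<open>z\<close> is uncovered, every other vertex is covered because it is separated
  from \<open>z\<close>. The value \<open>z = n + 1\<close> is the guess that all vertices are
  covered: nothing is removed from \<open>{..n}\<close>. The value \<open>z = n\<close> would drop
  the covering requirement altogether.\<close>

lemma uncovered_vertex:
  assumes J: "J \<subseteq> {..<m}" and c: "cov {..<n} J"
  shows "\<exists>z<n + 2. z \<noteq> n \<and> (\<forall>j\<in>J. z \<notin> set (es ! j)) \<and> cov (verts z) J"
proof (cases "\<exists>z<n. \<forall>j\<in>J. z \<notin> set (es ! j)")
  case True
  then obtain z where z: "z < n" "\<forall>j\<in>J. z \<notin> set (es ! j)" by blast
  have "cov (verts z) J"
    unfolding cov_def
  proof (intro ballI impI)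
    fix x y assume xy: "x \<in> verts z" "y \<in> verts z" "x \<noteq> y"
    \<comment> \<open>Inverse of \<open>twin z\<close>: separation from \<open>n\<close> is traded
      for separation from the uncovered vertex \<open>z\<close>.\<close>
    define h where "h = (\<lambda>x. if x = n then z else x)"
    have h: "twin z (h x) = x" "twin z (h y) = y" "h x < n" "h y < n" "h x \<noteq> h y"
      using xy z by (auto simp: h_def twin_def verts_def)
    then obtain j where "j \<in> J" "sep j (h x) (h y)" using c unfolding cov_def by blast
    then show "\<exists>j\<in>J. sep j x y" using sep_twin[of j z "h x" "h y"] J z h by auto
  qed
  then show ?thesis using z by (intro exI[of _ z]) auto
next
  case False
  have "cov (verts (n + 1)) J"
    unfolding cov_def
  proof (intro ballI impI)
    fix x y assume xy: "x \<in> verts (n + 1)" "y \<in> verts (n + 1)" "x \<noteq> y"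
    have n: "n \<notin> set (es ! j)" if "j \<in> J" for j using nth_less_n[of j n] J that by auto
    consider "x < n" "y < n" | "x = n" "y < n" | "y = n" "x < n"
      using xy by (auto simp: verts_def le_less)
    then show "\<exists>j\<in>J. sep j x y"
    proof cases
      case 1
      then show ?thesis using c xy unfolding cov_def by blast
    next
      case 2
      then show ?thesis using False n unfolding sep_def by blast
    next
      case 3
      then show ?thesis using False n unfolding sep_def by blast
    qed
  qed
  moreover have "\<forall>j\<in>J. n + 1 \<notin> set (es ! j)"
  proof
    fix j assume "j \<in> J"
    then show "n + 1 \<notin> set (es ! j)" using nth_less_n[of j "n + 1"] J by auto
  qed
  ultimately show ?thesis by (intro exI[of _ "n + 1"]) auto
qed

text \<open>The edges through \<open>z\<close> are all in \<open>S\<close>, since no edge outside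
  \<open>S\<close> contains \<open>z\<close>; so the path may start with them deleted, and they
  count towards \<open>q\<close>. For \<open>z = n + 1\<close> there are none.\<close>

lemma procedure_succeeds:
  assumes S: "S \<subseteq> {..<m}" "cov {..<n} ({..<m} - S)" "q \<le> card S"
  shows "\<exists>z<n + 2. \<exists>w<B ^ q. \<exists>D. path z q {j. j < m \<and> sep j z n} w D \<and>
    cov {..<n} ({..<m} - D) \<and> q \<le> card D"
proof -
  obtain z where z: "z < n + 2" "z \<noteq> n" "\<forall>j\<in>{..<m} - S. z \<notin> set (es ! j)"
    "cov (verts z) ({..<m} - S)"
    using uncovered_vertex[of "{..<m} - S"] S by auto
  define D0 where "D0 = {j. j < m \<and> sep j z n}"
  have "D0 \<subseteq> S" using z sep_n by (auto simp: D0_def)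
  then obtain w D where w: "w < B ^ q" "path z q D0 w D" "D0 \<subseteq> D" "D \<subseteq> {..<m}"
    "cov (verts z) ({..<m} - D)" "q \<le> card D"
    using path_exists[of D0 S z q q] S z by auto
  have "z \<notin> set (es ! j)" if "j \<in> {..<m} - D" for j
    using that w(3) sep_n by (auto simp: D0_def)
  then have "cov {..<n} ({..<m} - D)" using cov_verts_imp[of "{..<m} - D" z] w z by auto
  then show ?thesis using z w D0_def by blast
qed

end

section \<open>The program\<close>

text \<open>Register \<open>0\<close> is the acceptance flag, \<open>2\<close> to \<open>11\<close>
  are fixed after the setup, and those from \<open>20\<close> on are working registers; the gap lets
  one inequality tell the last two groups apart.\<close>

abbreviation (input) vAcc :: nat where "vAcc \<equiv> 0"
abbreviation (input) vN :: nat where "vN \<equiv> 2"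
abbreviation (input) vM :: nat where "vM \<equiv> 3"
abbreviation (input) vK :: nat where "vK \<equiv> 4"
abbreviation (input) vQ :: nat where "vQ \<equiv> 5"
abbreviation (input) vN1 :: nat where "vN1 \<equiv> 6"
abbreviation (input) vN2 :: nat where "vN2 \<equiv> 7"
abbreviation (input) vL :: nat where "vL \<equiv> 8"
abbreviation (input) vW :: nat where "vW \<equiv> 9"
abbreviation (input) vR :: nat where "vR \<equiv> 10"
abbreviation (input) vB :: nat where "vB \<equiv> 11"
abbreviation (input) vGuess :: nat where "vGuess \<equiv> 20"
abbreviation (input) vZ :: nat where "vZ \<equiv> 21"
abbreviation (input) vSkip :: nat where "vSkip \<equiv> 22"
abbreviation (input) vEx :: nat where "vEx \<equiv> 23"
abbreviation (input) vX :: nat where "vX \<equiv> 24"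
abbreviation (input) vY :: nat where "vY \<equiv> 25"
abbreviation (input) vJ :: nat where "vJ \<equiv> 26"
abbreviation (input) vP :: nat where "vP \<equiv> 27"
abbreviation (input) vI :: nat where "vI \<equiv> 28"
abbreviation (input) vInX :: nat where "vInX \<equiv> 29"
abbreviation (input) vInY :: nat where "vInY \<equiv> 30"
abbreviation (input) vSep :: nat where "vSep \<equiv> 31"
abbreviation (input) vFirst :: nat where "vFirst \<equiv> 32"
abbreviation (input) vOk :: nat where "vOk \<equiv> 33"
abbreviation (input) vT :: nat where "vT \<equiv> 34"
abbreviation (input) vPow :: nat where "vPow \<equiv> 35"
abbreviation (input) vC :: nat where "vC \<equiv> 36"
abbreviation (input) vDigit :: nat where "vDigit \<equiv> 37"
abbreviation (input) vCur :: nat where "vCur \<equiv> 38"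
abbreviation (input) vE :: nat where "vE \<equiv> 39"
abbreviation (input) va :: nat where "va \<equiv> 40"
abbreviation (input) vb :: nat where "vb \<equiv> 41"
abbreviation (input) vCount :: nat where "vCount \<equiv> 42"
abbreviation (input) vU :: nat where "vU \<equiv> 43"
abbreviation (input) vV :: nat where "vV \<equiv> 44"

definition Neq :: "exp \<Rightarrow> exp \<Rightarrow> exp" where
  "Neq a b = Plus (Minus a b) (Minus b a)"

lemma ev_Neq [simp]: "ev (Neq a b) s = 0 \<longleftrightarrow> ev a s = ev b s"
  by (auto simp: Neq_def)

lemma evars_Neq [simp]: "evars (Neq a b) = evars a \<union> evars b"
  by (auto simp: Neq_def)

text \<open>The machine has no multiplication. Only multiples by constants depending on
  \<open>r\<close> are needed, so unrolled addition has constant cost.\<close>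

fun mulc :: "nat \<Rightarrow> exp \<Rightarrow> exp" where
  "mulc 0 e = Lit 0"
| "mulc (Suc c) e = Plus e (mulc c e)"

lemma ev_mulc [simp]: "ev (mulc c e) s = c * ev e s"
  by (induction c) auto

lemma evars_mulc: "v \<in> evars (mulc c e) \<Longrightarrow> v \<in> evars e"
  by (induction c) auto

abbreviation When :: "exp \<Rightarrow> prog \<Rightarrow> prog" where
  "When e p \<equiv> Ite e p PSkip"

abbreviation Unless :: "exp \<Rightarrow> prog \<Rightarrow> prog" where
  "Unless e p \<equiv> Ite e PSkip p"

text \<open>\<open>Minus b a\<close> tests \<open>a < b\<close>. The memory cells from address \<open>vL\<close> on hold the flags of the
  deleted edges.\<close>

definition AddrP :: prog where
  "AddrP = Assign vP (Lit 3);;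
     For vI vM (When (Minus (Var vJ) (Var vI))
       (Assign vP (Plus (Plus (Var vP) (Deref (Var vP))) (Lit 1))))"

text \<open>The loop runs over \<open>vN\<close> and not over the size of the edge, which is in no
  fixed register; no edge has more than \<open>n\<close> vertices, and the guard cuts off the rest.
  The sums \<open>vP + 1 + vI\<close> skip the cell that holds the size.\<close>

definition SepP :: prog where
  "SepP = AddrP;; Assign vInX (Lit 0);; Assign vInY (Lit 0);;
     For vI vN (When (Minus (Deref (Var vP)) (Var vI))
       (Unless (Neq (Deref (Plus (Plus (Var vP) (Lit 1)) (Var vI))) (Var vX)) (Assign vInX (Lit 1));;
        Unless (Neq (Deref (Plus (Plus (Var vP) (Lit 1)) (Var vI))) (Var vY)) (Assign vInY (Lit 1))));;
     Assign vSep (Neq (Var vInX) (Var vInY))"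

text \<open>Because the counter runs down, the last assignment comes from the smallest suitable
  index.\<close>

definition FirstP :: prog where
  "FirstP = Assign vFirst (Var vM);;
     For vJ vM (Unless (Deref (Plus (Var vL) (Var vJ))) (When (Neq (Var vJ) (Var vEx))
       (SepP;; When (Var vSep) (Assign vFirst (Var vJ)))))"

text \<open>With \<open>n + 1\<close> rounds the loops include the vertex \<open>n\<close>, which
  stands for coverage.\<close>

definition CheckP :: prog where
  "CheckP = Assign vOk (Lit 1);;
     For vX vN1 (For vY vN1
       (When (Neq (Var vX) (Var vY)) (When (Neq (Var vX) (Var vSkip)) (When (Neq (Var vY) (Var vSkip))
         (FirstP;; Unless (Minus (Var vM) (Var vFirst)) (Assign vOk (Lit 0)))))))"

definition SelectP :: prog where
  "SelectP = Assign vE (Var vM);; Assign vSkip (Var vZ);;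
     For vEx vM (Unless (Deref (Plus (Var vL) (Var vEx)))
       (CheckP;; When (Var vOk) (Assign vE (Var vEx))))"

text \<open>The power of \<open>r\<^sup>2 + 1\<close> is built by \<open>vT\<close> multiplications,
  and quotient and remainder by repeated subtraction. At most \<open>r\<^sup>2 + 1\<close> rounds
  are enough because \<open>vCur\<close> has at most \<open>vT + 1\<close> digits left.\<close>

definition DigitP :: "nat \<Rightarrow> prog" where
  "DigitP r = Assign vPow (Lit 1);;
     For vC vQ (When (Minus (Var vT) (Var vC)) (Assign vPow (mulc (r\<^sup>2 + 1) (Var vPow))));;
     Assign vDigit (Lit 0);;
     For vC vB (Unless (Minus (Var vPow) (Var vCur))
       (Assign vCur (Minus (Var vCur) (Var vPow));; Assign vDigit (Plus (Var vDigit) (Lit 1))))"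

text \<open>Membership of the second vertex in the redundant edge is tested as separation from
  \<open>n\<close>. On meaningless digits arbitrary cells may be read, but the only store is
  relative to \<open>vL\<close>, so the input word stays intact.\<close>

definition DeleteP :: prog where
  "DeleteP = Assign vEx (Var vE);; Assign vJ (Var vE);; AddrP;;
     Assign vU (Deref (Plus (Plus (Var vP) (Lit 1)) (Var va)));;
     Assign vX (Var vU);; Assign vY (Var vN);; FirstP;; Assign vJ (Var vFirst);; AddrP;;
     Assign vV (Deref (Plus (Plus (Var vP) (Lit 1)) (Var vb)));;
     Assign vX (Var vV);; Assign vJ (Var vE);; SepP;;
     Assign vX (Var vU);; Unless (Var vSep) (Assign vY (Var vV));; FirstP;;
     Put (Plus (Var vL) (Var vFirst)) (Lit 1)"

text \<open>The digit is decoded by trying all \<open>r * r\<close> pairs, which avoids a division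
  by \<open>r\<close>.\<close>

definition BranchP :: "nat \<Rightarrow> prog" where
  "BranchP r = Ite (Neq (Var vDigit) (Lit (r * r)))
     (For va vR (For vb vR (Unless (Neq (Var vDigit) (Plus (mulc r (Var va)) (Var vb))) DeleteP)))
     (Put (Plus (Var vL) (Var vE)) (Lit 1))"

definition StepP :: "nat \<Rightarrow> prog" where
  "StepP r = DigitP r;; SelectP;; BranchP r"

text \<open>Every flag is overwritten, so nothing of the previous trial is left.\<close>

definition InitP :: prog where
  "InitP = For vJ vM (Assign vX (Var vZ);; Assign vY (Var vN);; SepP;;
     Put (Plus (Var vL) (Var vJ)) (Var vSep))"

text \<open>With \<open>vSkip = n\<close> the check is about the actual vertices only, without
  coverage; \<open>vEx = m\<close> excludes no edge.\<close>

definition FinalP :: prog where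
  "FinalP = Assign vSkip (Var vN);; Assign vEx (Var vM);; CheckP;; Assign vCount (Lit 0);;
     For vJ vM (When (Deref (Plus (Var vL) (Var vJ))) (Assign vCount (Plus (Var vCount) (Lit 1))));;
     When (Var vOk) (Unless (Minus (Var vK) (Var vCount)) (Assign vAcc (Lit 1)))"

definition TrialP :: "nat \<Rightarrow> prog" where
  "TrialP r = InitP;; Assign vCur (Var vGuess);; For vT vQ (StepP r);; FinalP"

definition MainP :: "nat \<Rightarrow> prog" where
  "MainP r = For vGuess vW (For vZ vN2 (TrialP r))"

text \<open>Truncated subtraction turns \<open>k - (k - m)\<close> into
  \<open>min k m\<close>.\<close>

definition ReadP :: "nat \<Rightarrow> prog" where
  "ReadP r = Assign vN (Deref (Lit 0));; Assign vM (Deref (Lit 1));; Assign vK (Deref (Lit 2));;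
     Assign vQ (Minus (Var vK) (Minus (Var vK) (Var vM)));;
     Assign vN1 (Plus (Var vN) (Lit 1));; Assign vN2 (Plus (Var vN) (Lit 2));;
     Assign vR (Lit r);; Assign vB (Lit (r\<^sup>2 + 1))"

definition SetupP :: "nat \<Rightarrow> prog" where
  "SetupP r = Assign vJ (Var vM);; AddrP;; Assign vL (Var vP);; Assign vW (Lit 1);;
     For vC vQ (Assign vW (mulc (r\<^sup>2 + 1) (Var vW)))"

section \<open>Registers and cells that the subprograms change\<close>

lemma writes_AddrP [simp]: "writes AddrP = {vP, vI}"
  by (auto simp: AddrP_def)

lemma no_puts_AddrP [simp]: "no_puts AddrP"
  by (simp add: AddrP_def)

lemma writes_SepP [simp]: "writes SepP = {vP, vI, vInX, vInY, vSep}"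
  by (auto simp: SepP_def)

lemma no_puts_SepP [simp]: "no_puts SepP"
  by (simp add: SepP_def)

lemma writes_FirstP [simp]: "writes FirstP = {vP, vI, vInX, vInY, vSep, vJ, vFirst}"
  by (auto simp: FirstP_def)

lemma no_puts_FirstP [simp]: "no_puts FirstP"
  by (simp add: FirstP_def)

lemma writes_CheckP [simp]:
  "writes CheckP = {vP, vI, vInX, vInY, vSep, vJ, vFirst, vX, vY, vOk}"
  by (auto simp: CheckP_def)

lemma no_puts_CheckP [simp]: "no_puts CheckP"
  by (simp add: CheckP_def)

lemma writes_SelectP [simp]:
  "writes SelectP = {vP, vI, vInX, vInY, vSep, vJ, vFirst, vX, vY, vOk, vE, vSkip, vEx}"
  by (auto simp: SelectP_def)

lemma no_puts_SelectP [simp]: "no_puts SelectP"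
  by (simp add: SelectP_def)

lemma writes_DigitP [simp]: "writes (DigitP r) = {vPow, vC, vDigit, vCur}"
  by (auto simp: DigitP_def)

lemma no_puts_DigitP [simp]: "no_puts (DigitP r)"
  by (simp add: DigitP_def)

lemma writes_DeleteP [simp]:
  "writes DeleteP = {vP, vI, vInX, vInY, vSep, vJ, vFirst, vX, vY, vEx, vU, vV}"
  by (auto simp: DeleteP_def)

lemma puts_above_if_no_puts: "no_puts p \<Longrightarrow> puts_above v p"
  by (induction p) auto

lemma puts_above_DeleteP [simp]: "puts_above vL DeleteP"
  by (simp add: DeleteP_def puts_above_if_no_puts)

lemma writes_BranchP [simp]:
  "writes (BranchP r) = {vP, vI, vInX, vInY, vSep, vJ, vFirst, vX, vY, vEx, vU, vV, va, vb}"
  by (auto simp: BranchP_def)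

lemma puts_above_BranchP [simp]: "puts_above vL (BranchP r)"
  by (simp add: BranchP_def)

lemma writes_FinalP [simp]:
  "writes FinalP = {vP, vI, vInX, vInY, vSep, vJ, vFirst, vX, vY, vOk, vSkip, vEx, vCount, vAcc}"
  by (auto simp: FinalP_def)

lemma no_puts_FinalP [simp]: "no_puts FinalP"
  by (simp add: FinalP_def)

lemma writes_StepP [simp]:
  "writes (StepP r) = {vP, vI, vInX, vInY, vSep, vJ, vFirst, vX, vY, vOk, vE, vSkip, vEx,
     vPow, vC, vDigit, vCur, vU, vV, va, vb}"
  by (auto simp: StepP_def)

lemma puts_above_StepP [simp]: "puts_above vL (StepP r)"
  by (simp add: StepP_def puts_above_if_no_puts)

lemma writes_InitP [simp]: "writes InitP = {vP, vI, vInX, vInY, vSep, vJ, vX, vY}"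
  by (auto simp: InitP_def)

lemma puts_above_InitP [simp]: "puts_above vL InitP"
  by (simp add: InitP_def puts_above_if_no_puts)

lemma writes_TrialP [simp]:
  "writes (TrialP r) = {vP, vI, vInX, vInY, vSep, vJ, vFirst, vX, vY, vOk, vE, vSkip, vEx,
     vPow, vC, vDigit, vCur, vU, vV, va, vb, vT, vCount, vAcc}"
  by (auto simp: TrialP_def)

lemma puts_above_TrialP [simp]: "puts_above vL (TrialP r)"
  by (simp add: TrialP_def puts_above_if_no_puts)

section \<open>Correctness of the program\<close>

text \<open>The searches behind \<open>first_sep\<close> and \<open>redundant\<close> with a
  starting index added, as the invariant of a downward loop needs it.\<close>

definition first_from :: "nat \<Rightarrow> (nat \<Rightarrow> bool) \<Rightarrow> nat \<Rightarrow> nat" where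
  "first_from m P i = (LEAST j. j = m \<or> i \<le> j \<and> j < m \<and> P j)"

lemma first_from_end [simp]: "first_from m P m = m"
  unfolding first_from_def by (rule Least_equality) auto

lemma first_from_step:
  assumes "i < m"
  shows "first_from m P i = (if P i then i else first_from m P (Suc i))"
proof (cases "P i")
  case True
  then show ?thesis unfolding first_from_def using assms by (auto intro!: Least_equality)
next
  case False
  then have "(\<lambda>j. j = m \<or> i \<le> j \<and> j < m \<and> P j) = (\<lambda>j. j = m \<or> Suc i \<le> j \<and> j < m \<and> P j)"
    by (auto simp: fun_eq_iff Suc_le_eq) (metis le_neq_implies_less)
  then show ?thesis using False by (simp add: first_from_def)
qed

lemma ex_from_step: "(\<exists>j\<ge>i. P j) \<longleftrightarrow> P i \<or> (\<exists>j\<ge>Suc i. P j)" for i :: nat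
  by (metis Suc_leD Suc_leI le_neq_implies_less le_refl)

section \<open>Layout of the input word\<close>

definition enc :: "nat list list \<Rightarrow> nat list" where
  "enc js = concat (map (\<lambda>e. length e # e) js)"

lemma enc_append: "enc (xs @ ys) = enc xs @ enc ys"
  by (simp add: enc_def)

lemma enc_Cons: "enc (x # xs) = (length x # x) @ enc xs"
  by (simp add: enc_def)

locale instance_word = hypergraph_word +
  fixes k :: nat
begin

definition word :: "nat list" where
  "word = n # m # k # enc es"

definition off :: "nat \<Rightarrow> nat" where
  "off j = 3 + length (enc (take j es))"

definition mem_ok :: "(nat \<Rightarrow> nat) \<Rightarrow> bool" where
  "mem_ok M \<longleftrightarrow> (\<forall>a<off m. M a = word ! a)"

lemma off_Suc: "j < m \<Longrightarrow> off (Suc j) = off j + length (es ! j) + 1"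
  by (simp add: off_def take_Suc_conv_app_nth enc_append enc_Cons) (simp add: enc_def)

lemma off_mono: "i \<le> j \<Longrightarrow> off i \<le> off j"
proof -
  assume "i \<le> j"
  then have "take j es = take i es @ take (j - i) (drop i es)"
    by (metis le_add_diff_inverse take_add)
  then show ?thesis by (simp add: off_def enc_append)
qed

lemma length_word: "length word = off m"
  by (simp add: word_def off_def)

lemma word_at:
  assumes j: "j < m" and i: "i \<le> length (es ! j)"
  shows "off j + i < off m" and "word ! (off j + i) = (length (es ! j) # es ! j) ! i"
proof -
  show "off j + i < off m"
    using off_Suc[OF j] off_mono[of "Suc j" m] i j by simp
  have "es = take j es @ es ! j # drop (Suc j) es" using j by (rule id_take_nth_drop)
  then have "enc es = enc (take j es) @ (length (es ! j) # es ! j) @ enc (drop (Suc j) es)"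
    by (metis enc_append enc_Cons)
  then have w: "word = ([n, m, k] @ enc (take j es)) @ (length (es ! j) # es ! j) @ enc (drop (Suc j) es)"
    by (simp add: word_def)
  have o: "off j = length ([n, m, k] @ enc (take j es))" by (simp add: off_def)
  have "word ! (off j + i) = ((length (es ! j) # es ! j) @ enc (drop (Suc j) es)) ! i"
    unfolding w o by (rule nth_append_length_plus)
  then show "word ! (off j + i) = (length (es ! j) # es ! j) ! i"
    using i by (simp add: nth_append del: append_Cons)
qed

lemma mem_size: "mem_ok M \<Longrightarrow> j < m \<Longrightarrow> M (off j) = length (es ! j)"
  using word_at[of j 0] by (simp add: mem_ok_def)

lemma mem_vertex: "mem_ok M \<Longrightarrow> j < m \<Longrightarrow> i < length (es ! j) \<Longrightarrow> M (Suc (off j + i)) = es ! j ! i"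
  using word_at[of j "Suc i"] by (simp add: mem_ok_def)

section \<open>Fixed registers and edge flags\<close>

definition ctx :: "state \<Rightarrow> bool" where
  "ctx s \<longleftrightarrow> fst s vN = n \<and> fst s vM = m \<and> fst s vK = k \<and> fst s vQ = min k m \<and> fst s vN1 = n + 1 \<and>
     fst s vN2 = n + 2 \<and> fst s vL = off m \<and> fst s vW = B ^ min k m \<and> fst s vR = r \<and> fst s vB = B \<and>
     mem_ok (snd s)"

lemma ctx_regs:
  assumes "ctx s"
  shows "fst s vN = n" "fst s vM = m" "fst s vK = k" "fst s vQ = min k m" "fst s vN1 = n + 1"
    "fst s vN2 = n + 2" "fst s vL = off m" "fst s vW = B ^ min k m" "fst s vR = r" "fst s vB = B"
    "mem_ok (snd s)"
  using assms unfolding ctx_def by blast+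

lemma ctx_update [simp]: "v = 0 \<or> 20 \<le> v \<Longrightarrow> ctx (f(v := x), M) \<longleftrightarrow> ctx (f, M)"
  by (auto simp: ctx_def)

lemma ctx_eta [simp]: "ctx s \<Longrightarrow> snd s = M \<Longrightarrow> ctx (fst s, M)"
  by auto

lemma ctx_store [simp]: "ctx (f, M) \<Longrightarrow> ctx (f, M(off m + a := x))"
  by (auto simp: ctx_def mem_ok_def)

text \<open>Working registers, the acceptance flag and the edge flags lie outside what
  \<open>ctx\<close> speaks of, so it is an invariant of everything after the setup.\<close>

lemma ctx_run:
  assumes "ctx s" "puts_above vL p" "\<forall>v\<in>writes p. v = 0 \<or> 20 \<le> v"
  shows "ctx (run p s)"
proof -
  have fr: "fst (run p s) v = fst s v" if "2 \<le> v" "v \<le> 11" for v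
    using that assms by (intro run_frame) auto
  have "snd (run p s) a = snd s a" if "a < fst s vL" for a
    using that assms by (intro run_puts_above) auto
  then have "mem_ok (snd (run p s))" using ctx_regs[OF assms(1)] by (simp add: mem_ok_def)
  then show ?thesis using assms(1) by (simp add: ctx_def fr)
qed

lemma ctx_run_no_puts [simp]:
  "ctx s \<Longrightarrow> no_puts p \<Longrightarrow> \<forall>v\<in>writes p. v = 0 \<or> 20 \<le> v \<Longrightarrow> ctx (run p s)"
  by (simp add: ctx_run puts_above_if_no_puts)

text \<open>The test \<open>j < m\<close> matters: a search without result yields \<open>m\<close>,
  and the store then hits the cell behind the flags.\<close>

definition dels :: "(nat \<Rightarrow> nat) \<Rightarrow> nat set" where
  "dels M = {j. j < m \<and> M (off m + j) \<noteq> 0}"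

lemma dels_store: "dels (M(off m + j := 1)) = dels M \<union> ({j} \<inter> {..<m})"
  by (auto simp: dels_def)

lemma dels_subset: "dels M \<subseteq> {..<m}"
  by (auto simp: dels_def)

text \<open>Exactly the rounds with counter below \<open>vJ\<close> advance the pointer by one edge.
  Before them the truncated difference in the invariant is \<open>0\<close>, and
  \<open>off 0\<close> is the \<open>3\<close> of the header. The case \<open>vJ = m\<close> yields
  the first address after the word.\<close>

lemma run_AddrP:
  assumes "fst s vM = m" "mem_ok (snd s)" "fst s vJ \<le> m"
  shows "fst (run AddrP s) vP = off (fst s vJ)"
proof -
  define I where "I i t \<longleftrightarrow> fst t vP = off (fst s vJ - i) \<and> fst t vJ = fst s vJ \<and> snd t = snd s"
    for i and t :: state
  have "I 0 (run AddrP s)"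
    unfolding AddrP_def run.simps(4)
  proof (rule for_invariant)
    show "I (fst (run (Assign vP (Lit 3)) s) vM) (run (Assign vP (Lit 3)) s)"
      using assms by (simp add: I_def off_def enc_def)
  next
    fix i t assume i: "i < fst (run (Assign vP (Lit 3)) s) vM" and I: "I (Suc i) t"
    have im: "i < m" using i assms by simp
    show "I i (run (When (Minus (Var vJ) (Var vI))
       (Assign vP (Plus (Plus (Var vP) (Deref (Var vP))) (Lit 1)))) ((fst t)(vI := i), snd t))"
    proof (cases "i < fst s vJ")
      case True
      then have "fst s vJ - i = Suc (fst s vJ - Suc i)" by simp
      moreover have "fst s vJ - Suc i < m" using True assms by simp
      ultimately show ?thesis using I True mem_size[OF assms(2)] by (simp add: I_def off_Suc)
    next
      case False
      then show ?thesis using I by (simp add: I_def)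
    qed
  qed
  then show ?thesis by (simp add: I_def)
qed

lemma run_SepP:
  assumes c: "ctx s" and j: "fst s vJ < m"
  shows "fst (run SepP s) vSep \<noteq> 0 \<longleftrightarrow> sep (fst s vJ) (fst s vX) (fst s vY)"
proof -
  define e where "e = es ! fst s vJ"
  define x y where "x = fst s vX" and "y = fst s vY"
  define s1 where "s1 = run (Assign vInY (Lit 0)) (run (Assign vInX (Lit 0)) (run AddrP s))"
  have s1: "ctx s1" "fst s1 vP = off (fst s vJ)" "fst s1 vX = x" "fst s1 vY = y" "fst s1 vInX = 0" "fst s1 vInY = 0"
    using c j ctx_regs[OF c] run_AddrP[of s]
    by (simp_all add: s1_def run_frame x_def y_def)
  \<comment> \<open>As the counter runs down, the positions already inspected are those from
    \<open>i\<close> on.\<close>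
  define Q where "Q z i \<longleftrightarrow> (\<exists>i'\<ge>i. i' < length e \<and> e ! i' = z)" for z i
  have Q_step: "Q z i \<longleftrightarrow> i < length e \<and> e ! i = z \<or> Q z (Suc i)" for z i
    unfolding Q_def by (rule ex_from_step)
  \<comment> \<open>The bounds by \<open>1\<close> make \<open>Neq\<close> of the two flags act as
    exclusive or.\<close>
  define I where "I i t \<longleftrightarrow> ctx t \<and> fst t vP = off (fst s vJ) \<and> fst t vX = x \<and> fst t vY = y \<and>
    (fst t vInX \<noteq> 0 \<longleftrightarrow> Q x i) \<and>
    (fst t vInY \<noteq> 0 \<longleftrightarrow> Q y i) \<and>
    fst t vInX \<le> 1 \<and> fst t vInY \<le> 1" for i and t :: state
  have len: "length e \<le> n" unfolding e_def using j by (intro length_le_n) simp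
  define p where "p = (When (Minus (Deref (Var vP)) (Var vI))
       (Unless (Neq (Deref (Plus (Plus (Var vP) (Lit 1)) (Var vI))) (Var vX)) (Assign vInX (Lit 1));;
        Unless (Neq (Deref (Plus (Plus (Var vP) (Lit 1)) (Var vI))) (Var vY)) (Assign vInY (Lit 1))))"
  define u where "u = run (For vI vN p) s1"
  have "I 0 u"
    unfolding u_def
  proof (rule for_invariant)
    show "I (fst s1 vN) s1" using s1 len ctx_regs[OF s1(1)] by (auto simp: I_def Q_def)
  next
    fix i t assume I: "I (Suc i) t"
    then have ct: "ctx t" by (simp add: I_def)
    have sz: "snd t (off (fst s vJ)) = length e"
      using mem_size[OF ctx_regs(11)[OF ct] j] by (simp add: e_def)
    have vx: "i < length e \<Longrightarrow> snd t (Suc (off (fst s vJ) + i)) = e ! i"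
      using mem_vertex[OF ctx_regs(11)[OF ct] j] by (simp add: e_def)
    show "I i (run p ((fst t)(vI := i), snd t))"
      using I sz vx by (cases "i < length e") (simp_all add: I_def p_def Q_step[of _ i])
  qed
  then have "fst u vInX \<noteq> 0 \<longleftrightarrow> x \<in> set e" "fst u vInY \<noteq> 0 \<longleftrightarrow> y \<in> set e"
    "fst u vInX \<le> 1" "fst u vInY \<le> 1"
    by (auto simp: I_def Q_def in_set_conv_nth)
  moreover have "run SepP s = run (Assign vSep (Neq (Var vInX) (Var vInY))) u"
    unfolding SepP_def p_def s1_def u_def by simp
  ultimately show ?thesis
    by (auto simp: sep_def simp flip: x_def y_def e_def)
qed

lemma first_sep_first_from:
  "first_sep D e x y = first_from m (\<lambda>j. j \<notin> D \<and> j \<noteq> e \<and> sep j x y) 0"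
  by (simp add: first_sep_def first_from_def)

lemma run_FirstP:
  assumes c: "ctx s"
  shows "fst (run FirstP s) vFirst = first_sep (dels (snd s)) (fst s vEx) (fst s vX) (fst s vY)"
proof -
  define x y e where "x = fst s vX" and "y = fst s vY" and "e = fst s vEx"
  define P where "P j \<longleftrightarrow> j \<notin> dels (snd s) \<and> j \<noteq> e \<and> sep j x y" for j
  define I where "I i t \<longleftrightarrow> ctx t \<and> snd t = snd s \<and> fst t vX = x \<and> fst t vY = y \<and> fst t vEx = e \<and>
    fst t vFirst = first_from m P i" for i and t :: state
  have "I 0 (run FirstP s)"
    unfolding FirstP_def run.simps(4)
  proof (rule for_invariant)
    show "I (fst (run (Assign vFirst (Var vM)) s) vM) (run (Assign vFirst (Var vM)) s)"
      using c ctx_regs[OF c] by (simp add: I_def x_def y_def e_def)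
  next
    fix i t assume i: "i < fst (run (Assign vFirst (Var vM)) s) vM" and I: "I (Suc i) t"
    have im: "i < m" using i ctx_regs[OF c] by simp
    define t0 where "t0 = ((fst t)(vJ := i), snd t)"
    have ct: "ctx t0" using I by (cases t) (simp add: I_def t0_def)
    have d: "snd t0 (fst t0 vL + i) \<noteq> 0 \<longleftrightarrow> i \<in> dels (snd s)"
      using I im ctx_regs[OF ct] by (simp add: dels_def I_def t0_def)
    have f0: "fst t0 vJ = i" "fst t0 vEx = e" "snd t0 = snd s" "fst t0 vX = x" "fst t0 vY = y"
      "fst t0 vFirst = first_from m P (Suc i)" using I by (simp_all add: I_def t0_def)
    have sp: "fst (run SepP t0) vSep \<noteq> 0 \<longleftrightarrow> sep i x y"
      using run_SepP[OF ct] im I by (simp add: t0_def I_def)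
    have ct1: "ctx (run SepP t0)" using ct by simp
    have fr: "snd (run SepP t0) = snd s" "fst (run SepP t0) vX = x" "fst (run SepP t0) vY = y"
      "fst (run SepP t0) vEx = e" "fst (run SepP t0) vJ = i"
      "fst (run SepP t0) vFirst = first_from m P (Suc i)"
      using f0 by (simp_all add: run_no_puts run_frame)
    have st: "first_from m P i = (if P i then i else first_from m P (Suc i))"
      using im by (rule first_from_step)
    show "I i (run (Unless (Deref (Plus (Var vL) (Var vJ))) (When (Neq (Var vJ) (Var vEx))
       (SepP;; When (Var vSep) (Assign vFirst (Var vJ))))) ((fst t)(vJ := i), snd t))"
      unfolding t0_def[symmetric]
      using f0 ct ct1 fr sp d by (auto simp: I_def st P_def)
  qed
  then show ?thesis
    unfolding first_sep_first_from by (simp add: I_def P_def[abs_def] x_def y_def e_def)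
qed

lemma all_less_step: "j \<le> b \<Longrightarrow> (\<forall>y. j \<le> y \<and> y \<le> b \<longrightarrow> P y) \<longleftrightarrow> P j \<and> (\<forall>y. Suc j \<le> y \<and> y \<le> b \<longrightarrow> P y)"
  for j b :: nat
  by (metis Suc_leD Suc_leI le_neq_implies_less le_refl)

lemma run_CheckP:
  assumes c: "ctx s"
  shows "fst (run CheckP s) vOk \<noteq> 0 \<longleftrightarrow>
    cov (verts (fst s vSkip)) ({..<m} - dels (snd s) - {fst s vEx})"
proof -
  define z e D where "z = fst s vSkip" and "e = fst s vEx" and "D = dels (snd s)"
  define C where "C x y \<longleftrightarrow> (x \<noteq> y \<longrightarrow> x \<noteq> z \<longrightarrow> y \<noteq> z \<longrightarrow> first_sep D e x y < m)" for x y
  define rows where "rows i \<longleftrightarrow> (\<forall>x. i \<le> x \<and> x \<le> n \<longrightarrow> (\<forall>y\<le>n. C x y))" for i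
  define row where "row i j \<longleftrightarrow> (\<forall>y. j \<le> y \<and> y \<le> n \<longrightarrow> C i y)" for i j
  define K where "K t \<longleftrightarrow> ctx t \<and> snd t = snd s \<and> fst t vSkip = z \<and> fst t vEx = e" for t :: state
  define p where "p = When (Neq (Var vX) (Var vY)) (When (Neq (Var vX) (Var vSkip))
    (When (Neq (Var vY) (Var vSkip)) (FirstP;; Unless (Minus (Var vM) (Var vFirst)) (Assign vOk (Lit 0)))))"
  define s1 where "s1 = run (Assign vOk (Lit 1)) s"
  have body: "K (run p t) \<and> fst (run p t) vX = fst t vX \<and>
      (fst (run p t) vOk \<noteq> 0 \<longleftrightarrow> fst t vOk \<noteq> 0 \<and> C (fst t vX) (fst t vY))" if t: "K t" for t
  proof -
    have ct: "ctx t" using t by (simp add: K_def)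
    have ct1: "ctx (run FirstP t)" using ct by simp
    have ff: "fst (run FirstP t) vFirst = first_sep D e (fst t vX) (fst t vY)"
      using run_FirstP[OF ct] t by (simp add: K_def D_def)
    have fr: "snd (run FirstP t) = snd s" "fst (run FirstP t) vSkip = z" "fst (run FirstP t) vEx = e"
      "fst (run FirstP t) vX = fst t vX" "fst (run FirstP t) vOk = fst t vOk"
      using t by (simp_all add: run_no_puts run_frame K_def)
    show ?thesis
      using t ct ct1 ff fr ctx_regs[OF ct1]
      by (auto simp: p_def C_def K_def)
  qed
  have inner: "K (run (For vY vN1 p) t) \<and>
      (fst (run (For vY vN1 p) t) vOk \<noteq> 0 \<longleftrightarrow> fst t vOk \<noteq> 0 \<and> row (fst t vX) 0)" if t: "K t" for t
  proof -
    define I where "I j u \<longleftrightarrow> K u \<and> fst u vX = fst t vX \<and>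
      (fst u vOk \<noteq> 0 \<longleftrightarrow> fst t vOk \<noteq> 0 \<and> row (fst t vX) j)" for j u
    have ct: "ctx t" using t by (simp add: K_def)
    have "I 0 (run (For vY vN1 p) t)"
    proof (rule for_invariant)
      show "I (fst t vN1) t" using t ctx_regs[OF ct] by (auto simp: I_def row_def)
    next
      fix j u assume j: "j < fst t vN1" and I: "I (Suc j) u"
      define u0 where "u0 = ((fst u)(vY := j), snd u)"
      have jn: "j \<le> n" using j ctx_regs[OF ct] by simp
      have u0: "K u0" "fst u0 vY = j" "fst u0 vX = fst t vX" "fst u0 vOk = fst u vOk"
        using I by (simp_all add: I_def K_def u0_def)
      have "row (fst t vX) j \<longleftrightarrow> C (fst t vX) j \<and> row (fst t vX) (Suc j)"
        unfolding row_def by (rule all_less_step[OF jn])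
      then have "I j (run p u0)" using body[OF u0(1)] u0 I by (auto simp: I_def)
      then show "I j (run p ((fst u)(vY := j), snd u))" by (simp add: u0_def)
    qed
    then show ?thesis by (simp add: I_def)
  qed
  define I where "I i u \<longleftrightarrow> K u \<and> (fst u vOk \<noteq> 0 \<longleftrightarrow> rows i)" for i u
  have s1: "K s1" "fst s1 vOk = 1" using c by (simp_all add: K_def s1_def z_def e_def)
  have cs1: "ctx s1" using s1 by (simp add: K_def)
  have "I 0 (run (For vX vN1 (For vY vN1 p)) s1)"
  proof (rule for_invariant)
    show "I (fst s1 vN1) s1" using s1 ctx_regs[OF cs1] by (auto simp: I_def rows_def)
  next
    fix i u assume i: "i < fst s1 vN1" and I: "I (Suc i) u"
    define u0 where "u0 = ((fst u)(vX := i), snd u)"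
    have i_n: "i \<le> n" using i ctx_regs[OF cs1] by simp
    have u0: "K u0" "fst u0 vX = i" "fst u0 vOk = fst u vOk"
      using I by (simp_all add: I_def K_def u0_def)
    have "rows i \<longleftrightarrow> (\<forall>y\<le>n. C i y) \<and> rows (Suc i)"
      unfolding rows_def by (rule all_less_step[OF i_n])
    then have "I i (run (For vY vN1 p) u0)"
      using inner[OF u0(1)] u0 I unfolding I_def row_def by auto
    then show "I i (run (For vY vN1 p) ((fst u)(vX := i), snd u))" by (simp only: u0_def)
  qed
  moreover have "run CheckP s = run (For vX vN1 (For vY vN1 p)) s1"
    unfolding CheckP_def p_def s1_def by simp
  ultimately have "fst (run CheckP s) vOk \<noteq> 0 \<longleftrightarrow> rows 0" unfolding I_def by metis
  also have "\<dots> \<longleftrightarrow> cov (verts z) ({..<m} - D - {e})"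
    unfolding rows_def C_def cov_def verts_def first_sep_less_iff by auto
  finally show ?thesis by (simp add: z_def e_def D_def)
qed

lemma redundant_first_from:
  "redundant z D = first_from m (\<lambda>e. e \<notin> D \<and> cov (verts z) ({..<m} - D - {e})) 0"
  by (simp add: redundant_def first_from_def)

lemma run_SelectP:
  assumes c: "ctx s"
  shows "fst (run SelectP s) vE = redundant (fst s vZ) (dels (snd s))"
proof -
  define z D where "z = fst s vZ" and "D = dels (snd s)"
  define P where "P e \<longleftrightarrow> e \<notin> D \<and> cov (verts z) ({..<m} - D - {e})" for e
  define s1 where "s1 = run (Assign vSkip (Var vZ)) (run (Assign vE (Var vM)) s)"
  define p where "p = Unless (Deref (Plus (Var vL) (Var vEx))) (CheckP;; When (Var vOk) (Assign vE (Var vEx)))"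
  define I where "I i t \<longleftrightarrow> ctx t \<and> snd t = snd s \<and> fst t vSkip = z \<and> fst t vE = first_from m P i"
    for i and t :: state
  have s1: "ctx s1" "snd s1 = snd s" "fst s1 vSkip = z" "fst s1 vE = m" "fst s1 vM = m"
    using c ctx_regs[OF c] by (simp_all add: s1_def z_def)
  have "I 0 (run (For vEx vM p) s1)"
  proof (rule for_invariant)
    show "I (fst s1 vM) s1" using s1 by (simp add: I_def)
  next
    fix i t assume i: "i < fst s1 vM" and I: "I (Suc i) t"
    have im: "i < m" using i s1 by simp
    define t0 where "t0 = ((fst t)(vEx := i), snd t)"
    have f0: "ctx t0" "snd t0 = snd s" "fst t0 vSkip = z" "fst t0 vE = first_from m P (Suc i)" "fst t0 vEx = i"
      using I by (simp_all add: I_def t0_def)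
    have d: "snd s (fst t0 vL + i) \<noteq> 0 \<longleftrightarrow> i \<in> D"
      using im ctx_regs[OF f0(1)] by (simp add: dels_def D_def)
    have ok: "fst (run CheckP t0) vOk \<noteq> 0 \<longleftrightarrow> cov (verts z) ({..<m} - D - {i})"
      using run_CheckP[OF f0(1)] f0 by (simp add: D_def)
    have ct1: "ctx (run CheckP t0)" using f0 by simp
    have fr: "snd (run CheckP t0) = snd s" "fst (run CheckP t0) vEx = i"
      "fst (run CheckP t0) vE = first_from m P (Suc i)"
      using f0 by (simp_all add: run_no_puts run_frame)
    have sk: "fst (run p t0) vSkip = z" if "vSkip \<notin> writes CheckP"
      using f0 that by (subst run_frame) (auto simp: p_def)
    have st: "first_from m P i = (if P i then i else first_from m P (Suc i))"
      using im by (rule first_from_step)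
    have "I i (run p t0)"
      using f0 sk fr ct1 ok d by (auto simp: I_def st P_def p_def)
    then show "I i (run p ((fst t)(vEx := i), snd t))" by (simp only: t0_def)
  qed
  moreover have "run SelectP s = run (For vEx vM p) s1"
    unfolding SelectP_def p_def s1_def by simp
  ultimately show ?thesis
    unfolding redundant_first_from by (simp add: I_def P_def[abs_def] z_def D_def)
qed

lemma run_DigitP:
  assumes c: "ctx s" and i: "i = fst s vT" "i < min k m" and w: "w = fst s vCur" "w < B ^ Suc i"
  shows "fst (run (DigitP r) s) vDigit = w div B ^ i" "fst (run (DigitP r) s) vCur = w mod B ^ i"
proof -
  define p1 where "p1 = When (Minus (Var vT) (Var vC)) (Assign vPow (mulc (r\<^sup>2 + 1) (Var vPow)))"
  define p2 where "p2 = Unless (Minus (Var vPow) (Var vCur))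
    (Assign vCur (Minus (Var vCur) (Var vPow));; Assign vDigit (Plus (Var vDigit) (Lit 1)))"
  define s1 where "s1 = run (Assign vPow (Lit 1)) s"
  define s2 where "s2 = run (For vC vQ p1) s1"
  define s3 where "s3 = run (Assign vDigit (Lit 0)) s2"
  define I1 where "I1 c t \<longleftrightarrow> ctx t \<and> fst t vPow = B ^ (i - c) \<and> fst t vT = i \<and> fst t vCur = w" for c t
  have I1: "I1 0 s2"
    unfolding s2_def
  proof (rule for_invariant)
    show "I1 (fst s1 vQ) s1" using c i w ctx_regs[OF c] by (simp add: I1_def s1_def)
  next
    fix c t assume I: "I1 (Suc c) t"
    show "I1 c (run p1 ((fst t)(vC := c), snd t))"
    proof (cases "c < i")
      case True
      then have "i - c = Suc (i - Suc c)" by simp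
      then show ?thesis using I True by (simp add: I1_def p1_def)
    next
      case False
      then show ?thesis using I by (simp add: I1_def p1_def)
    qed
  qed
  \<comment> \<open>The factor is \<open>Suc c\<close> and not \<open>c\<close>, so that after the
    last round, \<open>c = 0\<close>, the remainder is below \<open>B ^ i\<close>.\<close>
  define I2 where "I2 c t \<longleftrightarrow> fst t vPow = B ^ i \<and> fst t vDigit * B ^ i + fst t vCur = w \<and>
    fst t vCur < Suc c * B ^ i" for c and t :: state
  have s3: "ctx s3" using I1 by (simp add: s3_def I1_def)
  have "I2 0 (run (For vC vB p2) s3)"
  proof (rule for_invariant)
    have "w < Suc B * B ^ i" using w by simp
    then show "I2 (fst s3 vB) s3" using I1 ctx_regs(10)[OF s3] by (simp add: I2_def s3_def I1_def)
  next
    fix c t assume I: "I2 (Suc c) t"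
    then show "I2 c (run p2 ((fst t)(vC := c), snd t))"
      by (auto simp: I2_def p2_def not_le algebra_simps)
  qed
  moreover have "run (DigitP r) s = run (For vC vB p2) s3"
    unfolding DigitP_def p1_def p2_def s1_def s2_def s3_def by simp
  ultimately have "I2 0 (run (DigitP r) s)" by simp
  then have "fst (run (DigitP r) s) vDigit * B ^ i + fst (run (DigitP r) s) vCur = w"
    "fst (run (DigitP r) s) vCur < B ^ i" by (simp_all add: I2_def)
  then show "fst (run (DigitP r) s) vDigit = w div B ^ i" "fst (run (DigitP r) s) vCur = w mod B ^ i"
    by (metis add.commute div_mult_self3 div_less add_0 nat_neq_iff not_less_zero, metis mod_mult_self3 mod_less)
qed

lemma run_DeleteP:
  assumes c: "ctx s" and e: "e = fst s vE" "e < m" and a: "fst s va < length (es ! e)"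
    and x: "x = es ! e ! fst s va"
    and f: "f = first_sep (dels (snd s)) e x n" "f < m" and b: "fst s vb < length (es ! f)"
    and y: "y = es ! f ! fst s vb"
  shows "dels (snd (run DeleteP s)) =
    dels (snd s) \<union> ({first_sep (dels (snd s)) e x (if sep e y n then n else y)} \<inter> {..<m})"
proof -
  define s1 where "s1 = run AddrP ((fst s)(vEx := e, vJ := e), snd s)"
  have s1: "ctx s1" "snd s1 = snd s" "fst s1 vP = off e" "fst s1 vE = e" "fst s1 vEx = e"
    "fst s1 va = fst s va" "fst s1 vb = fst s vb"
    using c e ctx_regs[OF c] run_AddrP[of "((fst s)(vEx := e, vJ := e), snd s)"]
    by (simp_all add: s1_def run_no_puts run_frame)
  define s2 where "s2 = run FirstP ((fst s1)(vU := x, vX := x, vY := n), snd s)"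
  have s2: "ctx s2" "snd s2 = snd s" "fst s2 vE = e" "fst s2 vEx = e" "fst s2 vU = x" "fst s2 vY = n"
    "fst s2 vb = fst s vb" "fst s2 vFirst = f"
    using s1 f run_FirstP[of "((fst s1)(vU := x, vX := x, vY := n), snd s)"]
    by (simp_all add: s2_def run_no_puts run_frame)
  define s3 where "s3 = run AddrP ((fst s2)(vJ := f), snd s)"
  have s3: "ctx s3" "snd s3 = snd s" "fst s3 vP = off f" "fst s3 vE = e" "fst s3 vEx = e"
    "fst s3 vU = x" "fst s3 vY = n" "fst s3 vb = fst s vb"
    using s2 f ctx_regs[OF s2(1)] run_AddrP[of "((fst s2)(vJ := f), snd s)"]
    by (simp_all add: s3_def run_no_puts run_frame)
  define s4 where "s4 = run SepP ((fst s3)(vV := y, vX := y, vJ := e), snd s)"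
  have s4: "ctx s4" "snd s4 = snd s" "fst s4 vE = e" "fst s4 vEx = e" "fst s4 vU = x" "fst s4 vV = y"
    "fst s4 vY = n" "fst s4 vSep \<noteq> 0 \<longleftrightarrow> sep e y n"
    using s3 e run_SepP[of "((fst s3)(vV := y, vX := y, vJ := e), snd s)"]
    by (simp_all add: s4_def run_no_puts run_frame)
  define s5 where "s5 = run FirstP ((fst s4)(vX := x, vY := (if sep e y n then n else y)), snd s)"
  have s5: "ctx s5" "snd s5 = snd s"
    "fst s5 vFirst = first_sep (dels (snd s)) e x (if sep e y n then n else y)"
    using s4 run_FirstP[of "((fst s4)(vX := x, vY := (if sep e y n then n else y)), snd s)"]
    by (simp_all add: s5_def run_no_puts)
  have vx: "snd s (Suc (off e + fst s va)) = x" "snd s (Suc (off f + fst s vb)) = y"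
    using mem_vertex[OF ctx_regs(11)[OF c]] e a x f b y by simp_all
  have n: "fst s1 vN = n" using ctx_regs[OF s1(1)] by simp
  have t1: "run AddrP ((fst s)(vEx := fst s vE, vJ := fst s vE), snd s) = s1"
    by (simp add: s1_def e)
  have t2: "run FirstP ((fst s1)(vU := x, vX := x, vY := n), snd s) = s2"
    by (simp add: s2_def)
  have t3: "run AddrP ((fst s2)(vJ := f), snd s) = s3"
    by (simp add: s3_def)
  have t4: "run SepP ((fst s3)(vV := y, vX := y, vJ := e), snd s) = s4"
    by (simp add: s4_def)
  have t5: "run FirstP (if sep e y n then ((fst s4)(vX := x), snd s) else ((fst s4)(vX := x, vY := y), snd s)) = s5"
  proof (cases "sep e y n")
    case True
    \<comment> \<open>In this case the program skips the last assignment to \<open>vY\<close>, which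
      still holds the \<open>n\<close> of the first search.\<close>
    have "(fst s4)(vX := x, vY := n) = (fst s4)(vX := x)" using s4(7) by (auto simp: fun_eq_iff)
    then show ?thesis using True by (simp add: s5_def)
  qed (simp add: s5_def)
  have "run DeleteP s = (fst s5, (snd s)(off m + fst s5 vFirst := 1))"
    unfolding DeleteP_def
    using s1 s2 s3 s4 s5 vx n t1 t2 t3 t4 t5 ctx_regs[OF s5(1)]
    by (simp split del: if_split cong: if_cong)
  then show ?thesis by (simp only: snd_conv dels_store s5(3))
qed

lemma run_BranchP:
  assumes c: "ctx s" and e: "fst s vE = redundant (fst s vZ) (dels (snd s))"
    and st: "step (fst s vZ) (dels (snd s)) (fst s vDigit) D'"
  shows "dels (snd (run (BranchP r) s)) = D'"
proof -
  define D d where "D = dels (snd s)" and "d = fst s vDigit"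
  consider (eq) "d = r * r" "D' = D \<union> ({redundant (fst s vZ) D} \<inter> {..<m})"
    | (pair) a b e f x y where "e = redundant (fst s vZ) D" "e < m" "a < length (es ! e)"
      "x = es ! e ! a" "f = first_sep D e x n" "f < m" "b < length (es ! f)" "y = es ! f ! b"
      "d = r * a + b" "D' = D \<union> ({first_sep D e x (if sep e y n then n else y)} \<inter> {..<m})"
    using st unfolding step_def D_def[symmetric] d_def[symmetric] by (elim disjE exE conjE) assumption+
  then show ?thesis
  proof cases
    case eq
    then have "run (BranchP r) s = (fst s, (snd s)(off m + fst s vE := 1))"
      using ctx_regs(7)[OF c] by (simp add: BranchP_def d_def)
    then show ?thesis using eq e by (simp only: snd_conv dels_store D_def)
  next
    case (pair a b e f x y)
    have "length (es ! e) \<le> r" "length (es ! f) \<le> r" using pair by (auto intro: length_le_r)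
    then have ab: "a < r" "b < r" using pair by simp_all
    then have "r * a + b < r * Suc a" by simp
    also have "\<dots> \<le> r * r" using ab by (intro mult_left_mono) auto
    finally have ne: "d \<noteq> r * r" using pair(9) by simp
    \<comment> \<open>\<open>DeleteP\<close> must run in exactly one round, since a second run would
      start from changed flags. As \<open>j < r\<close>, the digit determines the pair by division
      with remainder.\<close>
    have hit: "d = r * i + j \<longleftrightarrow> i = a \<and> j = b" if "j < r" for i j
    proof
      assume h: "d = r * i + j"
      have "(r * i + j) div r = i" "(r * i + j) mod r = j" using that by auto
      moreover have "(r * a + b) div r = a" "(r * a + b) mod r = b" using ab by auto
      ultimately show "i = a \<and> j = b" using h pair(9) by metis
    qed (use pair in simp)
    define p where "p = Unless (Neq (Var vDigit) (Plus (mulc r (Var va)) (Var vb))) DeleteP"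
    define K where "K t \<longleftrightarrow> ctx t \<and> fst t vE = e \<and> fst t vDigit = d" for t :: state
    have body: "K (run p t) \<and> fst (run p t) va = fst t va \<and>
        dels (snd (run p t)) = (if fst t va = a \<and> fst t vb = b then D' else dels (snd t))"
      if t: "K t" "fst t vb < r" "fst t va = a \<and> fst t vb = b \<longrightarrow> dels (snd t) = D" for t
    proof (cases "fst t va = a \<and> fst t vb = b")
      case True
      have ct: "ctx t" using t by (simp add: K_def)
      have "ctx (run DeleteP t)" using ct by (rule ctx_run) simp_all
      moreover have "run p t = run DeleteP t" using True t pair by (simp add: p_def K_def)
      moreover have "dels (snd (run DeleteP t)) = D'"
        using run_DeleteP[OF ct, of e x f y] True t pair by (simp add: K_def)
      ultimately show ?thesis using t True by (simp add: K_def run_frame)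
    next
      case False
      then have "run p t = t" using hit[OF t(2), of "fst t va"] t by (simp add: p_def K_def)
      then show ?thesis using False t by auto
    qed
    have inner: "K (run (For vb vR p) t) \<and>
        dels (snd (run (For vb vR p) t)) = (if fst t va \<le> a then D' else D)"
      if t: "K t" "dels (snd t) = (if fst t va < a then D' else D)" for t
    proof -
      \<comment> \<open>Both counters run down, so the round \<open>(a, b)\<close> lies behind as
        soon as the current pair is lexicographically at most \<open>(a, b)\<close>.\<close>
      define I where "I j u \<longleftrightarrow> K u \<and> fst u va = fst t va \<and>
        dels (snd u) = (if fst t va < a \<or> fst t va = a \<and> j \<le> b then D' else D)" for j u
      have ct: "ctx t" using t by (simp add: K_def)
      have "I 0 (run (For vb vR p) t)"
      proof (rule for_invariant)
        show "I (fst t vR) t" using t ab ctx_regs[OF ct] by (auto simp: I_def)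
      next
        fix j u assume j: "j < fst t vR" and I: "I (Suc j) u"
        define u0 where "u0 = ((fst u)(vb := j), snd u)"
        have jr: "j < r" using j ctx_regs[OF ct] by simp
        have u0: "K u0" "fst u0 vb = j" "fst u0 va = fst t va" "snd u0 = snd u"
          using I by (simp_all add: I_def K_def u0_def)
        have "I j (run p u0)"
          using body[OF u0(1)] u0 jr I by (auto simp: I_def Suc_le_eq le_less)
        then show "I j (run p ((fst u)(vb := j), snd u))" by (simp only: u0_def)
      qed
      then show ?thesis by (auto simp: I_def)
    qed
    define I where "I i u \<longleftrightarrow> K u \<and> dels (snd u) = (if i \<le> a then D' else D)" for i u
    have "I 0 (run (For va vR (For vb vR p)) s)"
    proof (rule for_invariant)
      show "I (fst s vR) s" using c e pair ab ctx_regs[OF c] by (auto simp: I_def K_def D_def d_def)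
    next
      fix i u assume I: "I (Suc i) u"
      define u0 where "u0 = ((fst u)(va := i), snd u)"
      have "K u0" "fst u0 va = i" "snd u0 = snd u"
        using I by (simp_all add: I_def K_def u0_def)
      then have "I i (run (For vb vR p) u0)"
        using inner[of u0] I by (simp add: I_def Suc_le_eq)
      then show "I i (run (For vb vR p) ((fst u)(va := i), snd u))" by (simp only: u0_def)
    qed
    moreover have "run (BranchP r) s = run (For va vR (For vb vR p)) s"
      using ne by (simp add: BranchP_def p_def d_def)
    ultimately show ?thesis by (simp add: I_def)
  qed
qed

lemma run_StepP:
  assumes c: "ctx s" and i: "fst s vT = i" "i < min k m" and w: "fst s vCur < B ^ Suc i"
    and p: "path (fst s vZ) (Suc i) (dels (snd s)) (fst s vCur) D'"
  shows "path (fst s vZ) i (dels (snd (run (StepP r) s))) (fst (run (StepP r) s) vCur) D'"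
    and "fst (run (StepP r) s) vCur < B ^ i"
proof -
  define s1 where "s1 = run (DigitP r) s"
  define s2 where "s2 = run SelectP s1"
  define s3 where "s3 = run (BranchP r) s2"
  have run: "run (StepP r) s = s3" by (simp add: StepP_def s1_def s2_def s3_def)
  obtain D1 where D1: "step (fst s vZ) (dels (snd s)) (fst s vCur div B ^ i) D1"
    "path (fst s vZ) i D1 (fst s vCur mod B ^ i) D'" using p by auto
  have s1: "ctx s1" "snd s1 = snd s" "fst s1 vZ = fst s vZ"
    "fst s1 vDigit = fst s vCur div B ^ i" "fst s1 vCur = fst s vCur mod B ^ i"
    using c run_DigitP[OF c i(1)[symmetric] i(2) refl w]
    by (simp_all add: s1_def run_no_puts run_frame)
  have s2: "ctx s2" "snd s2 = snd s" "fst s2 vZ = fst s vZ"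
    "fst s2 vDigit = fst s vCur div B ^ i" "fst s2 vCur = fst s vCur mod B ^ i"
    "fst s2 vE = redundant (fst s vZ) (dels (snd s))"
    using s1 run_SelectP[OF s1(1)] by (simp_all add: s2_def run_no_puts run_frame)
  have "dels (snd s3) = D1"
    using run_BranchP[OF s2(1), of D1] s2 D1 by (simp add: s3_def)
  moreover have cur: "fst s3 vCur = fst s vCur mod B ^ i" using s2 by (simp add: s3_def run_frame)
  ultimately show "path (fst s vZ) i (dels (snd (run (StepP r) s))) (fst (run (StepP r) s) vCur) D'"
    using D1 run by simp
  show "fst (run (StepP r) s) vCur < B ^ i" using cur run by simp
qed

lemma run_InitP:
  assumes c: "ctx s"
  shows "dels (snd (run InitP s)) = {j. j < m \<and> sep j (fst s vZ) n}"
proof -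
  define z where "z = fst s vZ"
  define I where "I i t \<longleftrightarrow> ctx t \<and> fst t vZ = z \<and>
    (\<forall>j. i \<le> j \<and> j < m \<longrightarrow> (snd t (off m + j) \<noteq> 0 \<longleftrightarrow> sep j z n))" for i and t :: state
  have "I 0 (run InitP s)"
    unfolding InitP_def
  proof (rule for_invariant)
    show "I (fst s vM) s" using c ctx_regs[OF c] by (auto simp: I_def z_def)
  next
    fix i t assume i: "i < fst s vM" and I: "I (Suc i) t"
    define t0 where "t0 = ((fst t)(vJ := i, vX := z, vY := n), snd t)"
    have im: "i < m" using i ctx_regs[OF c] by simp
    have ct: "ctx t" using I by (simp add: I_def)
    then have t0: "ctx t0" by (simp add: t0_def)
    define t1 where "t1 = run SepP t0"
    have t1: "ctx t1" "snd t1 = snd t" "fst t1 vJ = i" "fst t1 vZ = z"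
      "fst t1 vSep \<noteq> 0 \<longleftrightarrow> sep i z n"
      using t0 I im run_SepP[OF t0] by (simp_all add: t1_def run_no_puts run_frame) (simp_all add: t0_def I_def)
    have "run (Assign vX (Var vZ);; Assign vY (Var vN);; SepP;;
      Put (Plus (Var vL) (Var vJ)) (Var vSep)) ((fst t)(vJ := i), snd t) =
      (fst t1, (snd t)(off m + i := fst t1 vSep))"
      using t1 I ctx_regs[OF t1(1)] ctx_regs[OF ct] by (simp add: I_def t1_def t0_def)
    moreover have "((snd t)(off m + i := fst t1 vSep)) (off m + j) \<noteq> 0 \<longleftrightarrow> sep j z n"
      if "i \<le> j" "j < m" for j
      using t1 I that by (cases "j = i") (simp_all add: I_def)
    then have "I i (fst t1, (snd t)(off m + i := fst t1 vSep))"
      using t1 I by (simp add: I_def)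
    ultimately show "I i (run (Assign vX (Var vZ);; Assign vY (Var vN);; SepP;;
      Put (Plus (Var vL) (Var vJ)) (Var vSep)) ((fst t)(vJ := i), snd t))" by (simp only:)
  qed
  then show ?thesis by (auto simp: I_def dels_def z_def)
qed

lemma run_FinalP:
  assumes c: "ctx s"
  shows "fst (run FinalP s) vAcc =
    (if cov {..<n} ({..<m} - dels (snd s)) \<and> k \<le> card (dels (snd s)) then 1 else fst s vAcc)"
proof -
  define D where "D = dels (snd s)"
  define s1 where "s1 = run CheckP ((fst s)(vSkip := n, vEx := m), snd s)"
  define s2 where "s2 = ((fst s1)(vCount := 0), snd s)"
  define p where "p = When (Deref (Plus (Var vL) (Var vJ))) (Assign vCount (Plus (Var vCount) (Lit 1)))"
  \<comment> \<open>Skipping the vertex \<open>n\<close> turns the check with coverage into the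
    plain test cover condition.\<close>
  have "verts n = {..<n}" "{..<m} - D - {m} = {..<m} - D" by (auto simp: verts_def)
  then have s1: "ctx s1" "snd s1 = snd s" "fst s1 vAcc = fst s vAcc"
    "fst s1 vOk \<noteq> 0 \<longleftrightarrow> cov {..<n} ({..<m} - D)"
    using c run_CheckP[of "((fst s)(vSkip := n, vEx := m), snd s)"]
    by (simp_all add: s1_def run_no_puts run_frame D_def)
  define I where "I i t \<longleftrightarrow> ctx t \<and> snd t = snd s \<and> fst t vOk = fst s1 vOk \<and> fst t vAcc = fst s vAcc \<and>
    fst t vCount = card (D \<inter> {i..<m})" for i and t :: state
  have s2: "ctx s2" "snd s2 = snd s" using s1 by (simp_all add: s2_def)
  have "I 0 (run (For vJ vM p) s2)"
  proof (rule for_invariant)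
    show "I (fst s2 vM) s2" using s1 s2 ctx_regs[OF s2(1)] by (simp add: I_def s2_def)
  next
    fix i t assume i: "i < fst s2 vM" and I: "I (Suc i) t"
    have im: "i < m" using i ctx_regs[OF s2(1)] by simp
    have ct: "ctx t" using I by (simp add: I_def)
    have mem: "snd s (off m + i) \<noteq> 0 \<longleftrightarrow> i \<in> D" using im by (simp add: D_def dels_def)
    have "{i..<m} = insert i {Suc i..<m}" using im by auto
    then have "card (D \<inter> {i..<m}) = card (D \<inter> {Suc i..<m}) + (if i \<in> D then 1 else 0)"
      by simp
    then show "I i (run p ((fst t)(vJ := i), snd t))"
      using I mem ctx_regs[OF ct] by (simp add: I_def p_def)
  qed
  moreover have "D \<inter> {0..<m} = D" using dels_subset[of "snd s"] by (auto simp: D_def)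
  ultimately have u: "I 0 (run (For vJ vM p) s2)" "fst (run (For vJ vM p) s2) vCount = card D"
    by (simp_all add: I_def del: run.simps)
  define u where "u = run (For vJ vM p) s2"
  have "ctx u" using u by (simp add: I_def u_def del: run.simps)
  moreover have "run FinalP s = run (When (Var vOk) (Unless (Minus (Var vK) (Var vCount)) (Assign vAcc (Lit 1)))) u"
    using ctx_regs[OF c] s1 by (simp add: FinalP_def p_def u_def s2_def s1_def)
  ultimately show ?thesis
    using u[folded u_def] s1(4) ctx_regs[of u] by (auto simp: I_def D_def)
qed

section \<open>Soundness and completeness of the trials\<close>

definition solvable :: bool where
  "solvable \<longleftrightarrow> (\<exists>S\<subseteq>{..<m}. cov {..<n} ({..<m} - S) \<and> k \<le> card S)"

text \<open>The flag is never cleared, and it is set only when the final set of deleted edges is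
  itself a solution, however it arose; \<open>path\<close> is needed for completeness alone.\<close>

lemma run_TrialP:
  assumes c: "ctx s"
  shows "fst s vAcc \<noteq> 0 \<Longrightarrow> fst (run (TrialP r) s) vAcc \<noteq> 0"
    and "fst (run (TrialP r) s) vAcc \<noteq> 0 \<Longrightarrow> fst s vAcc \<noteq> 0 \<or> solvable"
    and "path (fst s vZ) (min k m) {j. j < m \<and> sep j (fst s vZ) n} (fst s vGuess) D \<Longrightarrow>
      fst s vGuess < B ^ min k m \<Longrightarrow> cov {..<n} ({..<m} - D) \<Longrightarrow> k \<le> card D \<Longrightarrow>
      fst (run (TrialP r) s) vAcc \<noteq> 0"
proof -
  define s1 where "s1 = run (Assign vCur (Var vGuess)) (run InitP s)"
  define s2 where "s2 = run (For vT vQ (StepP r)) s1"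
  have run: "run (TrialP r) s = run FinalP s2" by (simp add: TrialP_def s1_def s2_def)
  have "ctx (run InitP s)" using c by (rule ctx_run) auto
  then have s1: "ctx s1" "fst s1 vAcc = fst s vAcc" "fst s1 vZ = fst s vZ" "fst s1 vCur = fst s vGuess"
    "dels (snd s1) = {j. j < m \<and> sep j (fst s vZ) n}"
    using run_InitP[OF c] by (simp_all add: s1_def run_frame)
  have c2: "ctx s2" unfolding s2_def using s1(1) by (rule ctx_run) auto
  have acc2: "fst s2 vAcc = fst s vAcc"
    unfolding s2_def using s1(2) by (simp add: run_frame del: run.simps)
  have acc: "fst (run (TrialP r) s) vAcc =
    (if cov {..<n} ({..<m} - dels (snd s2)) \<and> k \<le> card (dels (snd s2)) then 1 else fst s vAcc)"
    using run_FinalP[OF c2] acc2 run by simp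
  then show "fst s vAcc \<noteq> 0 \<Longrightarrow> fst (run (TrialP r) s) vAcc \<noteq> 0" by simp
  show "fst (run (TrialP r) s) vAcc \<noteq> 0 \<Longrightarrow> fst s vAcc \<noteq> 0 \<or> solvable"
    using acc dels_subset[of "snd s2"] by (auto simp: solvable_def split: if_splits)
  show "fst (run (TrialP r) s) vAcc \<noteq> 0"
    if p: "path (fst s vZ) (min k m) {j. j < m \<and> sep j (fst s vZ) n} (fst s vGuess) D"
      "fst s vGuess < B ^ min k m" "cov {..<n} ({..<m} - D)" "k \<le> card D"
  proof -
    define I where "I i t \<longleftrightarrow> ctx t \<and> fst t vZ = fst s vZ \<and>
      path (fst s vZ) i (dels (snd t)) (fst t vCur) D \<and> fst t vCur < B ^ i" for i and t :: state
    have "I 0 s2"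
      unfolding s2_def
    proof (rule for_invariant)
      show "I (fst s1 vQ) s1" using s1 p ctx_regs(4)[OF s1(1)] by (simp add: I_def)
    next
      fix i t assume i: "i < fst s1 vQ" and I: "I (Suc i) t"
      have iq: "i < min k m" using i ctx_regs(4)[OF s1(1)] by simp
      define t0 where "t0 = ((fst t)(vT := i), snd t)"
      have t0: "ctx t0" "fst t0 vT = i" "fst t0 vZ = fst s vZ" "snd t0 = snd t" "fst t0 vCur = fst t vCur"
        using I by (simp_all add: I_def t0_def)
      have "ctx (run (StepP r) t0)" using t0(1) by (rule ctx_run) auto
      moreover have "fst (run (StepP r) t0) vZ = fst s vZ" using t0 by (simp add: run_frame)
      moreover have "path (fst s vZ) i (dels (snd (run (StepP r) t0))) (fst (run (StepP r) t0) vCur) D"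
        "fst (run (StepP r) t0) vCur < B ^ i"
        using run_StepP[OF t0(1,2) iq, of D] I t0 unfolding I_def by auto
      ultimately have "I i (run (StepP r) t0)" by (simp add: I_def)
      then show "I i (run (StepP r) ((fst t)(vT := i), snd t))" by (simp only: t0_def)
    qed
    then have "dels (snd s2) = D" by (simp add: I_def)
    then show ?thesis using acc p by simp
  qed
qed

lemma run_MainP:
  assumes c: "ctx s" and z: "fst s vAcc = 0"
  shows "fst (run (MainP r) s) vAcc \<noteq> 0 \<longleftrightarrow> solvable"
proof -
  define good where "good g y \<longleftrightarrow> (\<exists>D. path y (min k m) {j. j < m \<and> sep j y n} g D \<and>
    g < B ^ min k m \<and> cov {..<n} ({..<m} - D) \<and> k \<le> card D)" for g y
  define K where "K t \<longleftrightarrow> ctx t \<and> (fst t vAcc \<noteq> 0 \<longrightarrow> solvable)" for t :: state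
  have body: "K (run (TrialP r) t) \<and> fst (run (TrialP r) t) vGuess = fst t vGuess \<and>
    (fst t vAcc \<noteq> 0 \<or> good (fst t vGuess) (fst t vZ) \<longrightarrow> fst (run (TrialP r) t) vAcc \<noteq> 0)"
    if t: "K t" for t
  proof -
    have ct: "ctx t" using t by (simp add: K_def)
    moreover have "ctx (run (TrialP r) t)" using ct by (rule ctx_run) auto
    ultimately show ?thesis
      using run_TrialP[OF ct] t unfolding K_def good_def by (auto simp: run_frame)
  qed
  have inner: "K (run (For vZ vN2 (TrialP r)) t) \<and>
    (fst t vAcc \<noteq> 0 \<or> (\<exists>y<n + 2. good (fst t vGuess) y) \<longrightarrow> fst (run (For vZ vN2 (TrialP r)) t) vAcc \<noteq> 0)"
    if t: "K t" for t
  proof -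
    have ct: "ctx t" using t by (simp add: K_def)
    define I where "I i u \<longleftrightarrow> K u \<and> fst u vGuess = fst t vGuess \<and>
      (fst t vAcc \<noteq> 0 \<or> (\<exists>y<n + 2. i \<le> y \<and> good (fst t vGuess) y) \<longrightarrow> fst u vAcc \<noteq> 0)" for i u
    have "I 0 (run (For vZ vN2 (TrialP r)) t)"
    proof (rule for_invariant)
      show "I (fst t vN2) t" using t ctx_regs(6)[OF ct] by (auto simp: I_def)
    next
      fix i u assume I: "I (Suc i) u"
      define u0 where "u0 = ((fst u)(vZ := i), snd u)"
      have u0: "K u0" "fst u0 vZ = i" "fst u0 vGuess = fst t vGuess" "fst u0 vAcc = fst u vAcc"
        using I by (simp_all add: I_def K_def u0_def)
      have "I i (run (TrialP r) u0)"
        unfolding I_def using body[OF u0(1)] u0 I[unfolded I_def] by (metis le_neq_implies_less Suc_leI)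
      then show "I i (run (TrialP r) ((fst u)(vZ := i), snd u))" by (simp only: u0_def)
    qed
    then show ?thesis unfolding I_def by blast
  qed
  define I where "I i u \<longleftrightarrow> K u \<and>
    ((\<exists>g<B ^ min k m. i \<le> g \<and> (\<exists>y<n + 2. good g y)) \<longrightarrow> fst u vAcc \<noteq> 0)" for i u
  have "I 0 (run (MainP r) s)"
    unfolding MainP_def
  proof (rule for_invariant)
    show "I (fst s vW) s" using c z ctx_regs(8)[OF c] by (auto simp: I_def K_def)
  next
    fix i u assume I: "I (Suc i) u"
    define u0 where "u0 = ((fst u)(vGuess := i), snd u)"
    have u0: "K u0" "fst u0 vGuess = i" "fst u0 vAcc = fst u vAcc"
      using I by (simp_all add: I_def K_def u0_def)
    have "I i (run (For vZ vN2 (TrialP r)) u0)"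
      unfolding I_def using inner[OF u0(1)] u0 I[unfolded I_def]
      by (metis le_neq_implies_less Suc_leI)
    then show "I i (run (For vZ vN2 (TrialP r)) ((fst u)(vGuess := i), snd u))" by (simp only: u0_def)
  qed
  then have res: "fst (run (MainP r) s) vAcc \<noteq> 0 \<longrightarrow> solvable"
    "(\<exists>g<B ^ min k m. \<exists>y<n + 2. good g y) \<longrightarrow> fst (run (MainP r) s) vAcc \<noteq> 0"
    by (simp_all add: I_def K_def)
  moreover have "\<exists>g<B ^ min k m. \<exists>y<n + 2. good g y" if sol: "solvable"
  proof -
    obtain S where S: "S \<subseteq> {..<m}" "cov {..<n} ({..<m} - S)" "k \<le> card S"
      using sol unfolding solvable_def by blast
    have "card S \<le> m" using card_mono[OF _ S(1)] by simp
    \<comment> \<open>A solvable instance has \<open>k \<le> m\<close>, so cutting the number of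
      digits at \<open>m\<close> loses no solution.\<close>
    then have km: "min k m = k" using S(3) by simp
    show ?thesis
      using procedure_succeeds[OF S] unfolding good_def km
      by (elim exE conjE) (intro exI conjI; assumption)
  qed
  ultimately show ?thesis by blast
qed

lemma run_setup:
  shows "ctx (run (SetupP r) (run (ReadP r) (init_state word)))"
    and "fst (run (SetupP r) (run (ReadP r) (init_state word))) vAcc = 0"
proof -
  define s where "s = run (ReadP r) (init_state word)"
  define s1 where "s1 = run AddrP ((fst s)(vJ := m), snd s)"
  define s2 where "s2 = ((fst s1)(vL := off m, vW := 1), snd s1)"
  define I where "I i t \<longleftrightarrow> snd t = snd s2 \<and> fst t vW = B ^ (min k m - i) \<and>
    (\<forall>v. v \<noteq> vW \<and> v \<noteq> vC \<longrightarrow> fst t v = fst s2 v)" for i and t :: state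
  have mem: "mem_ok (snd (init_state word))"
    by (simp add: mem_ok_def init_state_def length_word)
  have w: "snd (init_state word) 0 = n" "snd (init_state word) 1 = m" "snd (init_state word) 2 = k"
    by (simp_all add: init_state_def word_def)
  have s: "fst s vN = n" "fst s vM = m" "fst s vK = k" "fst s vQ = min k m" "fst s vN1 = n + 1"
    "fst s vN2 = n + 2" "fst s vR = r" "fst s vB = B" "fst s vAcc = 0" "snd s = snd (init_state word)"
    using w by (simp_all add: s_def ReadP_def) (simp add: init_state_def)
  have s1: "fst s1 vP = off m" "\<And>v. v \<noteq> vP \<Longrightarrow> v \<noteq> vI \<Longrightarrow> v \<noteq> vJ \<Longrightarrow> fst s1 v = fst s v"
    "snd s1 = snd s"
    using run_AddrP[of "((fst s)(vJ := m), snd s)"] s mem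
    by (simp_all add: s1_def run_frame run_no_puts)
  have "I 0 (run (For vC vQ (Assign vW (mulc (r\<^sup>2 + 1) (Var vW)))) s2)"
  proof (rule for_invariant)
    show "I (fst s2 vQ) s2" using s s1 by (simp add: I_def s2_def)
  next
    fix i t assume i: "i < fst s2 vQ" and I: "I (Suc i) t"
    have "i < min k m" using i s s1 by (simp add: s2_def)
    then have "min k m - i = Suc (min k m - Suc i)" by linarith
    then show "I i (run (Assign vW (mulc (r\<^sup>2 + 1) (Var vW))) ((fst t)(vC := i), snd t))"
      using I by (simp add: I_def)
  qed
  moreover have "run (SetupP r) s = run (For vC vQ (Assign vW (mulc (r\<^sup>2 + 1) (Var vW)))) s2"
    using s s1(1) by (simp add: SetupP_def s2_def s1_def)
  ultimately have "I 0 (run (SetupP r) s)" by simp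
  then have "ctx (run (SetupP r) s)" "fst (run (SetupP r) s) vAcc = 0"
    using s s1 mem by (simp_all add: I_def s2_def ctx_def)
  then show "ctx (run (SetupP r) (run (ReadP r) (init_state word)))"
    and "fst (run (SetupP r) (run (ReadP r) (init_state word))) vAcc = 0"
    by (simp_all add: s_def)
qed

end

section \<open>Execution and running time of the solver\<close>

lemma vars_MainP: "\<forall>v\<in>vars (MainP r). v < 50"
  by (auto simp: MainP_def TrialP_def FinalP_def InitP_def StepP_def BranchP_def DeleteP_def
      DigitP_def SelectP_def CheckP_def FirstP_def SepP_def AddrP_def dest!: evars_mulc)

lemma vars_SetupP: "\<forall>v\<in>vars (SetupP r). v < 50"
  by (auto simp: SetupP_def AddrP_def dest!: evars_mulc)

lemma vars_ReadP: "\<forall>v\<in>vars (ReadP r). v < 50"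
  by (auto simp: ReadP_def)

lemma loop_regs_TrialP: "loop_regs (TrialP r) \<subseteq> {vM, vN, vN1, vQ, vR, vB}"
  by (auto simp: TrialP_def FinalP_def InitP_def StepP_def BranchP_def DeleteP_def
      DigitP_def SelectP_def CheckP_def FirstP_def SepP_def AddrP_def)

text \<open>The phases are compiled separately because a program must not write its own loop
  registers: \<open>ReadP\<close> writes \<open>vM\<close> and \<open>vQ\<close>, which bound the
  loops of \<open>SetupP\<close>, and \<open>SetupP\<close> writes \<open>vW\<close>, which bounds
  the outermost loop of \<open>MainP\<close>.\<close>

definition solver :: "nat \<Rightarrow> com" where
  "solver r = Seq (compile (ReadP r) 50) (Seq (compile (SetupP r) 50) (compile (MainP r) 50))"

lemma exec_compile:
  assumes "\<forall>v\<in>vars p. v < T" "agrees T R (fst s)" "\<forall>v\<in>loop_regs p. v \<notin> writes p"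
  shows "\<exists>R' t. exec (compile p T) (R, snd s) t (R', snd (run p s)) \<and> t \<le> tcost (fst s) p \<and>
    agrees T R' (fst (run p s))"
  using compile_correct[OF assms(1,2) order_refl assms(3), of "fst s"] by blast

lemma exec_solver:
  assumes "s1 = run (ReadP r) (init_state xs)" "s2 = run (SetupP r) s1"
  shows "\<exists>t s. exec (solver r) (init_state xs) t s \<and> (accepting s \<longleftrightarrow> fst (run (MainP r) s2) vAcc \<noteq> 0) \<and>
    t \<le> tcost (fst (init_state xs)) (ReadP r) + (tcost (fst s1) (SetupP r) + tcost (fst s2) (MainP r))"
proof -
  obtain R1 t1 where 1: "exec (compile (ReadP r) 50) (init_state xs) t1 (R1, snd s1)"
    "t1 \<le> tcost (fst (init_state xs)) (ReadP r)" "agrees 50 R1 (fst s1)"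
    using exec_compile[OF vars_ReadP, of "fst (init_state xs)" "init_state xs" r]
    by (auto simp: assms(1) agrees_def ReadP_def)
  have "\<forall>v\<in>loop_regs (SetupP r). v \<notin> writes (SetupP r)" by (auto simp: SetupP_def AddrP_def)
  then obtain R2 t2 where 2: "exec (compile (SetupP r) 50) (R1, snd s1) t2 (R2, snd s2)"
    "t2 \<le> tcost (fst s1) (SetupP r)" "agrees 50 R2 (fst s2)"
    using exec_compile[OF vars_SetupP 1(3)] unfolding assms(2) by blast
  have "\<forall>v\<in>loop_regs (MainP r). v \<notin> writes (MainP r)"
    using loop_regs_TrialP[of r] by (auto simp: MainP_def)
  then obtain R3 t3 where 3: "exec (compile (MainP r) 50) (R2, snd s2) t3 (R3, snd (run (MainP r) s2))"
    "t3 \<le> tcost (fst s2) (MainP r)" "agrees 50 R3 (fst (run (MainP r) s2))"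
    using exec_compile[OF vars_MainP 2(3)] by blast
  have "exec (solver r) (init_state xs) (t1 + (t2 + t3)) (R3, snd (run (MainP r) s2))"
    unfolding solver_def by (intro exec.Seq[OF 1(1)] exec.Seq[OF 2(1)] 3(1))
  moreover have "accepting (R3, snd (run (MainP r) s2)) \<longleftrightarrow> fst (run (MainP r) s2) vAcc \<noteq> 0"
    using 3(3) by (simp add: accepting_def agrees_def)
  ultimately show ?thesis using 1(2) 2(2) 3(2) by (intro exI conjI) (assumption+, simp)
qed

text \<open>Applying \<open>tcost_polynomial\<close> to all of \<open>MainP\<close> would raise
  \<open>(r\<^sup>2 + 1) ^ k\<close> to some power. Therefore the outermost loop is split off and
  contributes this factor once; only its body gets a polynomial bound.\<close>

lemma solver_time:
  "\<exists>c. \<forall>N k b1 b2 b3. 2 \<le> N \<and> (\<forall>v\<in>loop_regs (ReadP r). b1 v \<le> N) \<and> (\<forall>v\<in>{vM, vQ}. b2 v \<le> N) \<and>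
     (\<forall>v\<in>{vM, vN, vN1, vN2, vQ}. b3 v \<le> N) \<and> (\<forall>v\<in>{vR, vB}. b3 v \<le> r\<^sup>2 + 1) \<and> b3 vW \<le> (r\<^sup>2 + 1) ^ k \<longrightarrow>
     tcost b1 (ReadP r) + (tcost b2 (SetupP r) + tcost b3 (MainP r)) \<le> (r\<^sup>2 + 1) ^ k * N ^ c"
proof -
  define q where "q = For vZ vN2 (TrialP r)"
  define B where "B = r\<^sup>2 + 1"
  obtain d1 where d1: "\<forall>N b. 2 \<le> N \<longrightarrow> (\<forall>v\<in>loop_regs (ReadP r). b v \<le> N) \<longrightarrow> tcost b (ReadP r) \<le> N ^ d1"
    using tcost_polynomial by blast
  obtain d2 where d2: "\<forall>N b. 2 \<le> N \<longrightarrow> (\<forall>v\<in>loop_regs (SetupP r). b v \<le> N) \<longrightarrow> tcost b (SetupP r) \<le> N ^ d2"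
    using tcost_polynomial by blast
  obtain d3 where d3: "\<forall>N b. 2 \<le> N \<longrightarrow> (\<forall>v\<in>loop_regs q. b v \<le> N) \<longrightarrow> tcost b q \<le> N ^ d3"
    using tcost_polynomial by blast
  define d where "d = d1 + d2 + d3"
  show ?thesis
  proof (rule exI[of _ "B * (4 + d)"], intro allI impI, elim conjE)
    fix N k b1 b2 b3
    assume N: "(2::nat) \<le> N" and b1: "\<forall>v\<in>loop_regs (ReadP r). b1 v \<le> N" and b2: "\<forall>v\<in>{vM, vQ}. b2 v \<le> N"
      and b3: "\<forall>v\<in>{vM, vN, vN1, vN2, vQ}. b3 v \<le> N" "\<forall>v\<in>{vR, vB}. b3 v \<le> r\<^sup>2 + 1"
      and W: "b3 vW \<le> (r\<^sup>2 + 1) ^ k"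
    \<comment> \<open>\<open>vR\<close> and \<open>vB\<close> are bounded in terms of
      \<open>r\<close>, not of \<open>N\<close>. Since \<open>B < 2 ^ B \<le> N ^ B\<close>, the
      base \<open>M\<close> exceeds these bounds as well; this is the origin of the factor
      \<open>B\<close> in the exponent.\<close>
    define M where "M = N ^ B"
    have "B < 2 ^ B" by (rule less_exp)
    also have "2 ^ B \<le> M" unfolding M_def using N by (rule power_mono) simp
    finally have BM: "B \<le> M" by simp
    have NM: "N \<le> M" unfolding M_def using N power_increasing[of 1 B N] by (simp add: B_def)
    have M2: "2 \<le> M" using N NM by simp
    have pw: "M ^ e \<le> M ^ d" if "e \<le> d" for e using that M2 by (intro power_increasing) auto
    have t1: "tcost b1 (ReadP r) \<le> M ^ d"
    proof -
      have "\<forall>v\<in>loop_regs (ReadP r). b1 v \<le> M" using b1 NM le_trans by blast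
      then have "tcost b1 (ReadP r) \<le> M ^ d1" using d1 M2 by blast
      also have "\<dots> \<le> M ^ d" by (rule pw) (simp add: d_def)
      finally show ?thesis .
    qed
    have t2: "tcost b2 (SetupP r) \<le> M ^ d"
    proof -
      have "loop_regs (SetupP r) \<subseteq> {vM, vQ}" by (auto simp: SetupP_def AddrP_def)
      then have "\<forall>v\<in>loop_regs (SetupP r). b2 v \<le> M" using b2 NM le_trans by blast
      then have "tcost b2 (SetupP r) \<le> M ^ d2" using d2 M2 by blast
      also have "\<dots> \<le> M ^ d" by (rule pw) (simp add: d_def)
      finally show ?thesis .
    qed
    have t3: "tcost b3 q \<le> M ^ d"
    proof -
      have "loop_regs q \<subseteq> {vM, vN, vN1, vN2, vQ} \<union> {vR, vB}"
        using loop_regs_TrialP[of r] by (auto simp: q_def)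
      moreover have "\<forall>v\<in>{vM, vN, vN1, vN2, vQ}. b3 v \<le> M" using b3(1) NM le_trans by blast
      moreover have "\<forall>v\<in>{vR, vB}. b3 v \<le> M" using b3(2) BM B_def le_trans by blast
      ultimately have "\<forall>v\<in>loop_regs q. b3 v \<le> M" by blast
      then have "tcost b3 q \<le> M ^ d3" using d3 M2 by blast
      also have "\<dots> \<le> M ^ d" by (rule pw) (simp add: d_def)
      finally show ?thesis .
    qed
    have one: "1 \<le> M ^ d" using M2 by simp
    have Bk: "1 \<le> B ^ k" by (simp add: B_def)
    have "b3 vW * (tcost b3 q + 4) \<le> B ^ k * (M ^ d + 4)"
      using W t3 by (intro mult_mono) (auto simp: B_def)
    then have main: "tcost b3 (MainP r) \<le> 2 + B ^ k * (M ^ d + 4)"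
      unfolding MainP_def q_def[symmetric] by simp
    have "tcost b1 (ReadP r) + (tcost b2 (SetupP r) + tcost b3 (MainP r)) \<le>
        2 * M ^ d + 2 + B ^ k * (M ^ d + 4)"
      using t1 t2 main by linarith
    also have "\<dots> \<le> B ^ k * (2 * M ^ d + 2) + B ^ k * (M ^ d + 4)"
      using mult_right_mono[OF Bk, of "2 * M ^ d + 2"] by simp
    also have "\<dots> = B ^ k * (3 * M ^ d + 6)" by (simp add: algebra_simps)
    \<comment> \<open>As \<open>1 \<le> M ^ d\<close>, the bracket is at most
      \<open>9 * M ^ d\<close>; rounding \<open>9\<close> up to a power of \<open>2\<close> lets
      \<open>M ^ 4\<close> absorb it.\<close>
    also have "\<dots> \<le> B ^ k * (2 ^ 4 * M ^ d)"
      by (rule mult_left_mono) (use one in simp_all)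
    also have "\<dots> \<le> B ^ k * (M ^ 4 * M ^ d)"
      using M2 by (intro mult_left_mono mult_right_mono power_mono) auto
    also have "\<dots> = B ^ k * N ^ (B * (4 + d))"
      by (simp only: M_def power_add power_mult)
    finally show "tcost b1 (ReadP r) + (tcost b2 (SetupP r) + tcost b3 (MainP r)) \<le>
        (r\<^sup>2 + 1) ^ k * N ^ (B * (4 + d))" by (simp only: B_def)
  qed
qed

section \<open>From edge indices to test covers\<close>

context instance_word
begin

lemma separates_iff_sep:
  assumes "x \<noteq> y"
  shows "separates (set (es ! j)) x y \<longleftrightarrow> sep j x y"
proof -
  let ?e = "set (es ! j)"
  consider "x \<in> ?e" "y \<in> ?e" "{x, y} \<inter> ?e = {x, y}" | "x \<in> ?e" "y \<notin> ?e" "{x, y} \<inter> ?e = {x}"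
    | "x \<notin> ?e" "y \<in> ?e" "{x, y} \<inter> ?e = {y}" | "x \<notin> ?e" "y \<notin> ?e" "{x, y} \<inter> ?e = {}"
    by blast
  then show ?thesis using assms by cases (simp_all add: separates_def sep_def)
qed

lemma test_cover_iff_cov: "test_cover {..<n} ((\<lambda>j. set (es ! j)) ` J) \<longleftrightarrow> cov {..<n} J"
  unfolding test_cover_def cov_def using separates_iff_sep by fastforce

text \<open>A test cover and the set of deleted indices are complementary. Distinct edges make
  indices and edges correspond one to one, so the cardinalities match.\<close>

lemma test_cover_solvable_iff:
  assumes d: "distinct (map set es)"
  shows "test_cover_solvable {..<n} (set ` set es) k \<longleftrightarrow> solvable"
proof -
  define A where "A j = set (es ! j)" for j
  have inj: "inj_on A {..<m}"
    using d by (auto simp: inj_on_def A_def distinct_conv_nth)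
  have E: "set ` set es = A ` {..<m}"
    unfolding A_def set_conv_nth[of es] by blast
  have cE: "card (set ` set es) = m" using inj by (simp add: E card_image)
  have tc: "test_cover {..<n} (A ` J) \<longleftrightarrow> cov {..<n} J" for J
    using test_cover_iff_cov by (simp add: A_def[abs_def])
  show ?thesis
  proof
    assume "test_cover_solvable {..<n} (set ` set es) k"
    then obtain T where T: "T \<subseteq> A ` {..<m}" "test_cover {..<n} T" "int (card T) \<le> int m - int k"
      unfolding test_cover_solvable_def cE unfolding E by blast
    define S where "S = {j. j < m \<and> A j \<notin> T}"
    have TA: "T = A ` ({..<m} - S)" using T(1) by (auto simp: S_def)
    have Sm: "S \<subseteq> {..<m}" by (auto simp: S_def)
    have "card T = card ({..<m} - S)"
      unfolding TA using inj by (intro card_image) (rule inj_on_subset, auto)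
    also have "\<dots> = m - card S" using Sm by (simp add: card_Diff_subset finite_subset)
    finally have "k \<le> card S" using T(3) card_mono[OF _ Sm] by simp
    moreover have "cov {..<n} ({..<m} - S)" using T(2) tc TA by simp
    ultimately show solvable using Sm unfolding solvable_def by blast
  next
    assume solvable
    then obtain S where S: "S \<subseteq> {..<m}" "cov {..<n} ({..<m} - S)" "k \<le> card S"
      unfolding solvable_def by blast
    define T where "T = A ` ({..<m} - S)"
    have "card T = card ({..<m} - S)"
      unfolding T_def using inj by (intro card_image) (rule inj_on_subset, auto)
    also have "\<dots> = m - card S" using S(1) by (simp add: card_Diff_subset finite_subset)
    finally have "int (card T) \<le> int m - int k" using S(3) card_mono[OF _ S(1)] by simp
    moreover have "test_cover {..<n} T" using S(2) tc by (simp add: T_def)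
    moreover have "T \<subseteq> A ` {..<m}" by (auto simp: T_def)
    ultimately show "test_cover_solvable {..<n} (set ` set es) k"
      unfolding test_cover_solvable_def cE unfolding E by blast
  qed
qed

end

theorem theorem9:
  fixes r :: nat
  assumes "2 \<le> r"
  shows "\<exists>P c. \<forall>V E k xs. test_r_cover_input r V E \<and> encodes xs V E k \<longrightarrow>
    (\<exists>t s. exec P (init_state xs) t s \<and>
       (accepting s \<longleftrightarrow> test_cover_solvable V E k) \<and>
       t \<le> (r\<^sup>2 + 1) ^ k * (card V + card E + 2) ^ c)"
proof -
  obtain c where c: "\<forall>N k b1 b2 b3. 2 \<le> N \<and> (\<forall>v\<in>loop_regs (ReadP r). b1 v \<le> N) \<and> (\<forall>v\<in>{vM, vQ}. b2 v \<le> N) \<and>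
     (\<forall>v\<in>{vM, vN, vN1, vN2, vQ}. b3 v \<le> N) \<and> (\<forall>v\<in>{vR, vB}. b3 v \<le> r\<^sup>2 + 1) \<and> b3 vW \<le> (r\<^sup>2 + 1) ^ k \<longrightarrow>
     tcost b1 (ReadP r) + (tcost b2 (SetupP r) + tcost b3 (MainP r)) \<le> (r\<^sup>2 + 1) ^ k * N ^ c"
    using solver_time by blast
  show ?thesis
  proof (rule exI[of _ "solver r"], rule exI[of _ c], intro allI impI, elim conjE)
    fix V :: "nat set" and E k xs
    assume inp: "test_r_cover_input r V E" and en: "encodes xs V E k"
    obtain n es where e: "V = {..<n}" "E = set ` set es" "distinct (map set es)" "\<forall>e\<in>set es. distinct e"
      "xs = n # length es # k # concat (map (\<lambda>e. length e # e) es)"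
      using en unfolding encodes_def by blast
    interpret instance_word n r es k
    proof
      fix l assume l: "l \<in> set es"
      then have "set l \<subseteq> {..<n}" "card (set l) \<le> r"
        using inp e(1,2) unfolding test_r_cover_input_def by auto
      moreover have "card (set l) = length l" using l e(4) by (simp add: distinct_card)
      moreover have "card (set l) \<le> n" using card_mono[OF _ \<open>set l \<subseteq> {..<n}\<close>] by simp
      ultimately show "set l \<subseteq> {..<n}" "length l \<le> n" "length l \<le> r" by simp_all
    qed
    have xs: "xs = word" unfolding word_def enc_def by (rule e(5))
    define s1 where "s1 = run (ReadP r) (init_state xs)"
    define s2 where "s2 = run (SetupP r) s1"
    \<comment> \<open>The summand \<open>2\<close> gives the base \<open>N \<ge> 2\<close> and room
      for the \<open>n + 2\<close> guesses of \<open>z\<close>.\<close>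
    define N where "N = n + m + 2"
    have ctx: "ctx s2" "fst s2 vAcc = 0"
      using run_setup by (simp_all add: s1_def s2_def xs)
    have cards: "card V + card E + 2 = N"
      using e(1,2,3) by (simp add: N_def distinct_card[of "map set es", simplified])
    have "B ^ min k m \<le> B ^ k" by (rule power_increasing) simp_all
    then have regs2: "fst s2 vM = m" "fst s2 vN = n" "fst s2 vN1 = n + 1" "fst s2 vN2 = n + 2"
      "fst s2 vQ \<le> m" "fst s2 vR \<le> B" "fst s2 vB \<le> B" "fst s2 vW \<le> B ^ k"
      using ctx_regs[OF ctx(1)] self_le_power[of r 2] assms by (simp_all only: min.cobounded2) simp_all
    have "fst s2 v = fst s1 v" if "v \<in> {vM, vQ}" for v
      unfolding s2_def using that by (intro run_frame) (auto simp: SetupP_def)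
    then have regs1: "fst s1 vM = m" "fst s1 vQ \<le> m" using regs2 by simp_all
    have "tcost (fst (init_state xs)) (ReadP r) + (tcost (fst s1) (SetupP r) + tcost (fst s2) (MainP r))
        \<le> B ^ k * N ^ c"
      using regs1 regs2 by (intro c[rule_format]) (auto simp: N_def ReadP_def)
    then show "\<exists>t s. exec (solver r) (init_state xs) t s \<and>
       (accepting s \<longleftrightarrow> test_cover_solvable V E k) \<and>
       t \<le> (r\<^sup>2 + 1) ^ k * (card V + card E + 2) ^ c"
      using exec_solver[OF s1_def s2_def] run_MainP[OF ctx] test_cover_solvable_iff[OF e(3)]
      unfolding cards unfolding e(1,2) by (meson le_trans)
  qed
qed

end
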